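(* Let $C\subset\mathbb{R}_+^N$ be a compact convex set containing the standard simplex $\Sigma$, let $K\subset\mathbb{C}^N$ be compact and let $w\colon K\to[0,\infty)$ be continuous. Then the limit $$D^w(K):=\lim_{k\to\infty}\bigl(V_k^w(K,M_k)\bigr)^{1/(kM_k)}$$ exists, and $$D^w(K)=\exp\left(\frac{1}{\mathrm{vol}_N(C)}\int_{\mathrm{int}(C)}\log T^w_{\prec}(K,\theta)\,d\theta\right).$$ Moreover the weighted $C$-transfinite diameter is given by $\delta_C^w(K)=D^w(K)^{1/A_N}$, where $$A_N=\frac{1}{\mathrm{vol}_N(C)}\int_C(\theta_1+\cdots+\theta_N)\,d\theta .$$
   Context: $\mathbb{R}_+=[0,\infty)$, $\mathbb{N}=\{1,2,\dots\}$, and $\Sigma=\{x\in\mathbb{R}^N: x_1,\dots,x_N\ge 0,\ x_1+\cdots+x_N\le 1\}$. $\mathrm{vol}_N$ is $N$-dimensional Lebesgue measure, with $d\theta$ the corresponding integration, and $\mathrm{int}(C)$ is the interior of $C$. Conventions: $\log 0=-\infty$, $\exp(-\infty)=0$. For $k\in\mathbb{N}$, $\mathrm{Poly}(kC)$ is the space of complex polynomials $\sum_{J\in kC\cap\mathbb{Z}^N}c_Jz^J$ in $z\in\mathbb{C}^N$. $M_k$ is the number of points of $kC\cap\mathbb{Z}^N$, and $L_k=\sum_{\alpha\in kC\cap\mathbb{Z}^N}|\alpha|$, where $|\alpha|=\alpha_1+\cdots+\alpha_N$ (the ordinary degree of $z^\alpha$). Ordering: $\alpha\prec\beta$ on $\mathbb{Z}^N$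 means that either $|\alpha|<|\beta|$, or $|\alpha|=|\beta|$ and there is $m\in\{1,\dots,N\}$ with $\alpha_m<\beta_m$ and $\alpha_j=\beta_j$ for all $j<m$. Chebyshev constants: for $\alpha\in kC\cap\mathbb{Z}^N$, let $\mathcal{M}_k^{\prec}(\alpha)$ be the set of polynomials of the form $z^\alpha+\sum_{\beta\in kC\cap\mathbb{Z}^N,\ \beta\prec\alpha}a_\beta z^\beta$ with $a_\beta\in\mathbb{C}$. Let $\nu_k(p)=\|w^kp\|_K=\sup_{z\in K}|w(z)^kp(z)|$, and $T_k^{\prec}(\nu_k,\alpha)=\inf\{\nu_k(p):p\in\mathcal{M}_k^{\prec}(\alpha)\}^{1/k}$. For $\theta\in\mathrm{int}(C)$ the directional Chebyshev constant is $$T^w_{\prec}(K,\theta)=\lim_{k\to\infty,\ \alpha/k\to\theta}T_k^{\prec}(\nu_k,\alpha)$$ (limit along any pairs $(k,\alpha)$ with $\alpha\in kC\cap\mathbb{Z}^N$, $k\to\infty$, $\alpha/k\to\theta$); this limit is known to exist for every $\theta\in\mathrm{int}(C)$. Transfinite diameter: let $\alpha(1),\dots,\alpha(M_k)$ be an enumeration of $kC\cap\mathbb{Z}^N$, and set $$V_k^w(K,M_k)=\sup\bigl\{\bigl|\det[\,w(\zeta_l)^k\zeta_l^{\alpha(j)}\,]_{j,l=1}^{M_k}\bigr|:\zeta_1,\dots,\zeta_{M_k}\in K\bigr\}$$ (independent of the enumeration). The weighted $C$-transfinite diameter is $\delta_C^w(K)=\limsup_{k\to\infty}\bigl(V_k^w(K,M_k)\bigr)^{1/L_k}$.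 *)

theory Defs
  imports "Jordan_Normal_Form.Determinant" "HOL-Analysis.Analysis"
begin

no_notation Matrix.vec_index (infixl \<open>$\<close> 100)

text \<open>
  The dimension \<open>N\<close> is \<open>CARD('n)\<close> for a finite linearly ordered index type \<open>'n\<close>, whose order
  plays the role of the order of \<open>{1,\<dots>,N}\<close>.
\<close>

definition std_simplex :: "(real ^ 'n::finite) set" where
  "std_simplex = {x. (\<forall>i. 0 \<le> x $ i) \<and> (\<Sum>i\<in>UNIV. x $ i) \<le> 1}"

text \<open>
  Multi-indices are vectors of natural numbers. As \<open>C\<close> lies in the nonnegative orthant, this gives
  all the integer points of \<open>k C\<close>.
\<close>

definition real_vec :: "nat ^ 'n \<Rightarrow> real ^ 'n::finite" where
  "real_vec \<alpha> = (\<chi> i. real (\<alpha> $ i))"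

definition lattice_pts :: "(real ^ 'n::finite) set \<Rightarrow> nat \<Rightarrow> (nat ^ 'n) set" where
  "lattice_pts C k = {\<alpha>. real_vec \<alpha> \<in> (\<lambda>x. real k *\<^sub>R x) ` C}"

definition num_pts :: "(real ^ 'n::finite) set \<Rightarrow> nat \<Rightarrow> nat" where
  "num_pts C k = card (lattice_pts C k)"

definition mdeg :: "nat ^ 'n::finite \<Rightarrow> nat" where
  "mdeg \<alpha> = (\<Sum>i\<in>UNIV. \<alpha> $ i)"

definition deg_sum :: "(real ^ 'n::finite) set \<Rightarrow> nat \<Rightarrow> nat" where
  "deg_sum C k = (\<Sum>\<alpha>\<in>lattice_pts C k. mdeg \<alpha>)"

definition prec :: "nat ^ 'n::{finite,linorder} \<Rightarrow> nat ^ 'n::{finite,linorder} \<Rightarrow> bool" where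
  "prec \<alpha> \<beta> \<longleftrightarrow> mdeg \<alpha> < mdeg \<beta> \<or>
     (mdeg \<alpha> = mdeg \<beta> \<and> (\<exists>m. \<alpha> $ m < \<beta> $ m \<and> (\<forall>j<m. \<alpha> $ j = \<beta> $ j)))"

definition monomial :: "nat ^ 'n \<Rightarrow> complex ^ 'n::finite \<Rightarrow> complex" where
  "monomial \<alpha> z = (\<Prod>i\<in>UNIV. z $ i ^ (\<alpha> $ i))"

text \<open>
  Supremum in the ordered set of nonnegative reals: for a nonempty bounded set of nonnegative reals
  this is its supremum in \<open>\<real>\<close>, and the supremum of the empty set is \<open>0\<close>. This only matters
  for \<open>K = {}\<close>, where \<open>Sup {} :: real\<close> would be an unspecified number.
\<close>

definition Sup_nonneg :: "real set \<Rightarrow> real" where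
  "Sup_nonneg S = Sup (insert 0 S)"

definition monic_polys ::
  "(real ^ 'n::{finite,linorder}) set \<Rightarrow> nat \<Rightarrow> nat ^ 'n::{finite,linorder} \<Rightarrow> (complex ^ 'n::{finite,linorder} \<Rightarrow> complex) set" where
  "monic_polys C k \<alpha> =
     {\<lambda>z. monomial \<alpha> z + (\<Sum>\<beta>\<in>{\<beta>\<in>lattice_pts C k. prec \<beta> \<alpha>}. a \<beta> * monomial \<beta> z) |a. True}"

definition weighted_norm ::
  "(complex ^ 'n::finite) set \<Rightarrow> (complex ^ 'n \<Rightarrow> real) \<Rightarrow> nat \<Rightarrow> (complex ^ 'n \<Rightarrow> complex) \<Rightarrow> real" where
  "weighted_norm K w k p = Sup_nonneg ((\<lambda>z. cmod (of_real (w z) ^ k * p z)) ` K)"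

definition cheb ::
  "(real ^ 'n::{finite,linorder}) set \<Rightarrow> (complex ^ 'n::{finite,linorder}) set \<Rightarrow> (complex ^ 'n::{finite,linorder} \<Rightarrow> real) \<Rightarrow> nat
    \<Rightarrow> nat ^ 'n::{finite,linorder} \<Rightarrow> real" where
  "cheb C K w k \<alpha> = (Inf (weighted_norm K w k ` monic_polys C k \<alpha>)) powr (1 / real k)"

text \<open>
  The filter of pairs \<open>(k, \<alpha>)\<close> with \<open>\<alpha> \<in> k C \<inter> \<int>\<^sup>N\<close>, \<open>k \<rightarrow> \<infinity>\<close> and
  \<open>\<alpha>/k \<rightarrow> \<theta>\<close>.
\<close>

definition direction_filter ::
  "(real ^ 'n::finite) set \<Rightarrow> real ^ 'n \<Rightarrow> (nat \<times> (nat ^ 'n)) filter" where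
  "direction_filter C \<theta> =
     inf (filtercomap (\<lambda>(k, \<alpha>). (k, (1 / real k) *\<^sub>R real_vec \<alpha>)) (sequentially \<times>\<^sub>F nhds \<theta>))
         (principal (SIGMA k:UNIV. lattice_pts C k))"

definition directional_cheb ::
  "(real ^ 'n::{finite,linorder}) set \<Rightarrow> (complex ^ 'n::{finite,linorder}) set \<Rightarrow> (complex ^ 'n::{finite,linorder} \<Rightarrow> real)
    \<Rightarrow> real ^ 'n::{finite,linorder} \<Rightarrow> real" where
  "directional_cheb C K w \<theta> = Lim (direction_filter C \<theta>) (\<lambda>(k, \<alpha>). cheb C K w k \<alpha>)"

text \<open>
  \<open>e k 0, \<dots>, e k (num_pts C k - 1)\<close> is the enumeration of \<open>k C \<inter> \<int>\<^sup>N\<close> that is used.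
\<close>

definition vandermonde ::
  "(nat \<Rightarrow> nat \<Rightarrow> nat ^ 'n) \<Rightarrow> (real ^ 'n) set \<Rightarrow> (complex ^ 'n::finite) set
    \<Rightarrow> (complex ^ 'n \<Rightarrow> real) \<Rightarrow> nat \<Rightarrow> real" where
  "vandermonde e C K w k = Sup_nonneg
     {cmod (Determinant.det (Matrix.mat (num_pts C k) (num_pts C k)
        (\<lambda>(j, l). of_real (w (\<zeta> l)) ^ k * monomial (e k j) (\<zeta> l)))) |\<zeta>.
      \<forall>l<num_pts C k. \<zeta> l \<in> K}"

definition diam_seq ::
  "(nat \<Rightarrow> nat \<Rightarrow> nat ^ 'n) \<Rightarrow> (real ^ 'n) set \<Rightarrow> (complex ^ 'n::finite) set
    \<Rightarrow> (complex ^ 'n \<Rightarrow> real) \<Rightarrow> nat \<Rightarrow> real" where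
  "diam_seq e C K w k = vandermonde e C K w k powr (1 / (real k * real (num_pts C k)))"

definition diam_lim ::
  "(nat \<Rightarrow> nat \<Rightarrow> nat ^ 'n) \<Rightarrow> (real ^ 'n) set \<Rightarrow> (complex ^ 'n::finite) set
    \<Rightarrow> (complex ^ 'n \<Rightarrow> real) \<Rightarrow> real" where
  "diam_lim e C K w = lim (diam_seq e C K w)"

definition transfinite_diam ::
  "(nat \<Rightarrow> nat \<Rightarrow> nat ^ 'n) \<Rightarrow> (real ^ 'n) set \<Rightarrow> (complex ^ 'n::finite) set
    \<Rightarrow> (complex ^ 'n \<Rightarrow> real) \<Rightarrow> ereal" where
  "transfinite_diam e C K w =
     limsup (\<lambda>k. ereal (vandermonde e C K w k powr (1 / real (deg_sum C k))))"

definition ln_ext :: "real \<Rightarrow> ereal" where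
  "ln_ext x = (if x = 0 then - \<infinity> else ereal (ln x))"

definition exp_ext :: "ereal \<Rightarrow> ereal" where
  "exp_ext x = (if x = - \<infinity> then 0 else if x = \<infinity> then \<infinity> else ereal (exp (real_of_ereal x)))"

text \<open>
  The Lebesgue integral of an extended-real-valued function, as the integral of the positive part
  minus that of the negative part (\<open>e2ennreal\<close> sends negative numbers to \<open>0\<close>). It is
  meaningful when \<open>ext_integral_defined\<close> holds.
\<close>

definition ext_integral_defined :: "'a measure \<Rightarrow> ('a \<Rightarrow> ereal) \<Rightarrow> bool" where
  "ext_integral_defined M f \<longleftrightarrow> f \<in> borel_measurable M \<and>
     ((\<integral>\<^sup>+x. e2ennreal (f x) \<partial>M) \<noteq> \<infinity> \<or> (\<integral>\<^sup>+x. e2ennreal (- f x) \<partial>M) \<noteq> \<infinity>)"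

definition ext_integral :: "'a measure \<Rightarrow> ('a \<Rightarrow> ereal) \<Rightarrow> ereal" where
  "ext_integral M f =
     enn2ereal (\<integral>\<^sup>+x. e2ennreal (f x) \<partial>M) - enn2ereal (\<integral>\<^sup>+x. e2ennreal (- f x) \<partial>M)"

definition mean_degree :: "(real ^ 'n::finite) set \<Rightarrow> real" where
  "mean_degree C = 1 / measure lebesgue C * (LINT \<theta>|lebesgue_on C. (\<Sum>i\<in>UNIV. \<theta> $ i))"

end

theory Submission
  imports Defs
begin

text \<open>
  The quantities \<open>min_weighted C K w k \<alpha>\<close> are submultiplicative on the semigroup of lattice points of
  the cone over \<open>C\<close>, which gives the limits in interior directions. It also gives a dichotomy: either
  the limit vanishes in every interior direction, or all the \<open>k\<close>-th roots are bounded below by one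
  positive constant, up to the boundary of \<open>C\<close>. Adding the points of a Fekete configuration one at a
  time compares the Vandermonde supremum with the product of the \<open>min_weighted C K w k \<alpha>\<close>, up to a
  factor \<open>M\<^sub>k!\<close>, which disappears in the limit. The averages of the logarithms are Riemann sums, and
  converge by dominated convergence; when the limits vanish, the same is applied after truncating
  from below.
\<close>

section \<open>Maximal determinants and minimal norms\<close>

text \<open>The factorial is harmless because of the normalisation: its \<open>1/(k M_k)\<close>-th
  power is at most \<open>M_k^(1/k)\<close>, and \<open>M_k\<close> grows only like
  \<open>k^N\<close>. The real obstacle is the boundary of \<open>C\<close>. Nothing guarantees
  limits of the k-th roots in boundary directions, and although the boundary is a null set, a few
  extremely small factors there could drag the whole geometric mean down. Monomials give a uniform
  upper bound at once; a uniform lower bound is what dominated convergence of the logarithms still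
  requires, and it cannot hold when the limits are 0. This is why the dichotomy has to reach the
  boundary and why mixed behaviour must be excluded. Submultiplicativity combines two facts:
  convexity puts \<open>kC + lC\<close> inside \<open>(k+l)C\<close>, and the order of exponents is
  invariant under translation. The passage from \<open>D^w(K)\<close> to the transfinite diameter is
  a change of exponent: \<open>L_k/(k M_k)\<close> tends to \<open>A_N\<close>, because the degree
  sum, divided by k, is a Riemann sum too.\<close>

definition fun_det :: "(nat \<Rightarrow> 'a \<Rightarrow> complex) \<Rightarrow> nat \<Rightarrow> (nat \<Rightarrow> 'a) \<Rightarrow> complex" where
  "fun_det f m \<zeta> = Determinant.det (Matrix.mat m m (\<lambda>(i, l). f i (\<zeta> l)))"

definition max_det :: "(nat \<Rightarrow> 'a \<Rightarrow> complex) \<Rightarrow> 'a set \<Rightarrow> nat \<Rightarrow> real" where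
  "max_det f K m = Sup_nonneg {cmod (fun_det f m \<zeta>) |\<zeta>. \<forall>l<m. \<zeta> l \<in> K}"

definition min_norm :: "(nat \<Rightarrow> 'a \<Rightarrow> complex) \<Rightarrow> 'a set \<Rightarrow> nat \<Rightarrow> real" where
  "min_norm f K m = Inf (range (\<lambda>a. Sup_nonneg ((\<lambda>z. cmod (f m z + (\<Sum>i<m. a i * f i z))) ` K)))"

lemma Sup_nonneg_nonneg: "bdd_above S \<Longrightarrow> 0 \<le> Sup_nonneg S"
  unfolding Sup_nonneg_def by (rule cSup_upper) auto

lemma Sup_nonneg_upper: "bdd_above S \<Longrightarrow> x \<in> S \<Longrightarrow> x \<le> Sup_nonneg S"
  unfolding Sup_nonneg_def by (rule cSup_upper) auto

lemma Sup_nonneg_least: "0 \<le> u \<Longrightarrow> (\<And>x. x \<in> S \<Longrightarrow> x \<le> u) \<Longrightarrow> Sup_nonneg S \<le> u"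
  unfolding Sup_nonneg_def by (rule cSup_least) auto

lemma fun_det_cong:
  assumes "\<And>i l. i < m \<Longrightarrow> l < m \<Longrightarrow> f i (\<zeta> l) = g i (\<xi> l)"
  shows "fun_det f m \<zeta> = fun_det g m \<xi>"
  unfolding fun_det_def by (rule arg_cong[of _ _ Determinant.det]) (use assms in auto)

lemma fun_det_0: "fun_det f 0 \<zeta> = 1"
  unfolding fun_det_def by (simp add: Determinant.det_def)

lemma fun_det_eq_0:
  assumes "i < m" "j < m" "i \<noteq> j" "\<And>l. l < m \<Longrightarrow> f i (\<zeta> l) = f j (\<zeta> l)"
  shows "fun_det f m \<zeta> = 0"
  unfolding fun_det_def
  by (rule Determinant.det_identical_rows[of _ m i j]) (use assms in auto)

text \<open>The cofactors of the last row do not see that row, so a single \<open>c\<close> serves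
  every \<open>g\<close>; this makes the determinant linear in its last function.
  \<open>insert_index l\<close> skips \<open>l\<close>, so \<open>c l\<close> is, up to sign, the
  determinant of the remaining points.\<close>

lemma fun_det_expand_last_row:
  obtains c where
    "\<And>g. fun_det (f(m := g)) (Suc m) \<zeta> = (\<Sum>l<Suc m. g (\<zeta> l) * c l)"
    "\<And>l. l < Suc m \<Longrightarrow> cmod (c l) = cmod (fun_det f m (\<lambda>i. \<zeta> (insert_index l i)))"
proof -
  define A where "A = (\<lambda>g. Matrix.mat (Suc m) (Suc m) (\<lambda>(i, l). (f(m := g)) i (\<zeta> l)))"
  have del: "mat_delete (A g) m l = Matrix.mat m m (\<lambda>(i, j). f i (\<zeta> (insert_index l j)))" 
    if "l < Suc m" for g l
    using that by (auto simp: mat_delete_def A_def insert_index_def)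
  show thesis
  proof (rule that)
    fix g
    have "fun_det (f(m := g)) (Suc m) \<zeta> = Determinant.det (A g)"
      by (simp add: fun_det_def A_def)
    also have "\<dots> = (\<Sum>l<Suc m. A g $$ (m, l) * cofactor (A g) m l)"
      by (rule laplace_expansion_row) (auto simp: A_def)
    also have "\<dots> = (\<Sum>l<Suc m. g (\<zeta> l) * cofactor (A (f m)) m l)"
      by (rule sum.cong) (auto simp: cofactor_def del, simp_all add: A_def)
    finally show "fun_det (f(m := g)) (Suc m) \<zeta> = (\<Sum>l<Suc m. g (\<zeta> l) * cofactor (A (f m)) m l)" .
  next
    fix l assume "l < Suc m"
    then show "cmod (cofactor (A (f m)) m l) = cmod (fun_det f m (\<lambda>i. \<zeta> (insert_index l i)))"
      by (simp add: cofactor_def del fun_det_def norm_mult norm_power)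
  qed
qed

lemma fun_det_expand_last_point:
  obtains c where
    "\<And>z. fun_det f (Suc m) (\<zeta>(m := z)) = f m z * fun_det f m \<zeta> + (\<Sum>i<m. f i z * c i)"
proof -
  define A where "A = (\<lambda>z. Matrix.mat (Suc m) (Suc m) (\<lambda>(i, l). f i ((\<zeta>(m := z)) l)))"
  have del: "mat_delete (A z) i m =
      Matrix.mat m m (\<lambda>(i', j). f (insert_index i i') (\<zeta> j))" if "i < Suc m" for z i
    using that by (auto simp: mat_delete_def A_def insert_index_def)
  show thesis
  proof (rule that)
    fix z
    have "fun_det f (Suc m) (\<zeta>(m := z)) = Determinant.det (A z)"
      by (simp add: fun_det_def A_def)
    also have "\<dots> = (\<Sum>i<Suc m. A z $$ (i, m) * cofactor (A z) i m)"
      by (rule laplace_expansion_column) (auto simp: A_def)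
    \<comment> \<open>The cofactors delete column \<open>m\<close>, the only one containing
      \<open>z\<close>; \<open>undefined\<close> stands for an arbitrary point there.\<close>
    also have "\<dots> = (\<Sum>i<Suc m. f i z * cofactor (A undefined) i m)"
      by (rule sum.cong) (auto simp: cofactor_def del, simp_all add: A_def)
    also have "\<dots> = f m z * fun_det f m \<zeta> + (\<Sum>i<m. f i z * cofactor (A undefined) i m)"
    proof -
      have "cofactor (A undefined) m m = fun_det f m \<zeta>"
        unfolding cofactor_def
        by (subst del) (auto simp: fun_det_def insert_index_def intro!: arg_cong[of _ _ Determinant.det])
      then show ?thesis by simp
    qed
    finally show "fun_det f (Suc m) (\<zeta>(m := z)) =
      f m z * fun_det f m \<zeta> + (\<Sum>i<m. f i z * cofactor (A undefined) i m)" .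
  qed
qed

context
  fixes f :: "nat \<Rightarrow> 'a \<Rightarrow> complex" and K :: "'a set"
  assumes bounded_f: "\<And>i. bounded (f i ` K)"
begin

lemma bdd_above_comb: "bdd_above ((\<lambda>z. cmod (f m z + (\<Sum>i<m. a i * f i z))) ` K)"
proof -
  have "\<forall>i. \<exists>b. \<forall>z\<in>K. cmod (f i z) \<le> b"
    using bounded_f by (auto simp: bounded_iff)
  then obtain b where b: "\<And>i z. z \<in> K \<Longrightarrow> cmod (f i z) \<le> b i" by metis
  show ?thesis
  proof (rule bdd_aboveI2)
    fix z assume z: "z \<in> K"
    have "cmod (f m z + (\<Sum>i<m. a i * f i z)) \<le> cmod (f m z) + (\<Sum>i<m. cmod (a i * f i z))"
      by (rule order_trans[OF norm_triangle_ineq add_left_mono[OF norm_sum]])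
    also have "\<dots> \<le> b m + (\<Sum>i<m. cmod (a i) * b i)"
      using b z by (intro add_mono sum_mono) (auto simp: norm_mult intro!: mult_left_mono)
    finally show "cmod (f m z + (\<Sum>i<m. a i * f i z)) \<le> b m + (\<Sum>i<m. cmod (a i) * b i)" .
  qed
qed

lemma min_norm_nonneg: "0 \<le> min_norm f K m"
  unfolding min_norm_def
  by (rule cINF_greatest) (auto intro!: Sup_nonneg_nonneg bdd_above_comb)

lemma bdd_below_comb:
  "bdd_below (range (\<lambda>a. Sup_nonneg ((\<lambda>z. cmod (f m z + (\<Sum>i<m. a i * f i z))) ` K)))"
  by (rule bdd_belowI[of _ 0]) (auto intro!: Sup_nonneg_nonneg bdd_above_comb)

text \<open>Row operations put a monic combination of the functions into the last row.\<close>

lemma fun_det_Suc_le: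
  assumes "\<forall>l<Suc m. \<zeta> l \<in> K"
    and D: "\<And>\<zeta>. \<forall>l<m. \<zeta> l \<in> K \<Longrightarrow> cmod (fun_det f m \<zeta>) \<le> D"
  shows "cmod (fun_det f (Suc m) \<zeta>)
    \<le> real (Suc m) * D * Sup_nonneg ((\<lambda>z. cmod (f m z + (\<Sum>i<m. a i * f i z))) ` K)"
proof -
  obtain c where c: "\<And>g. fun_det (f(m := g)) (Suc m) \<zeta> = (\<Sum>l<Suc m. g (\<zeta> l) * c l)"
    and c_norm: "\<And>l. l < Suc m \<Longrightarrow> cmod (c l) = cmod (fun_det f m (\<lambda>i. \<zeta> (insert_index l i)))"
    using fun_det_expand_last_row[where f = f and \<zeta> = \<zeta> and m = m] by blast
  define g where "g = (\<lambda>z. f m z + (\<Sum>i<m. a i * f i z))"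
  define s where "s = Sup_nonneg ((\<lambda>z. cmod (g z)) ` K)"
  have s: "cmod (g z) \<le> s" if "z \<in> K" for z
    unfolding s_def g_def using that by (intro Sup_nonneg_upper bdd_above_comb) auto
  have "fun_det (f(m := f i)) (Suc m) \<zeta> = 0" if "i < m" for i
    by (rule fun_det_eq_0[of i _ m]) (use that in auto)
  then have zero: "(\<Sum>l<Suc m. f i (\<zeta> l) * c l) = 0" if "i < m" for i
    using c[of "f i"] that by simp
  have "(\<Sum>l<Suc m. g (\<zeta> l) * c l) =
      (\<Sum>l<Suc m. f m (\<zeta> l) * c l) + (\<Sum>l<Suc m. \<Sum>i<m. a i * (f i (\<zeta> l) * c l))"
    by (simp add: g_def algebra_simps sum.distrib sum_distrib_left sum_distrib_right del: sum.lessThan_Suc)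
  also have "(\<Sum>l<Suc m. \<Sum>i<m. a i * (f i (\<zeta> l) * c l)) = (\<Sum>i<m. a i * (\<Sum>l<Suc m. f i (\<zeta> l) * c l))"
    by (subst sum.swap) (simp add: sum_distrib_left del: sum.lessThan_Suc)
  also have "\<dots> = 0"
    using zero by (intro sum.neutral) auto
  finally have "fun_det f (Suc m) \<zeta> = (\<Sum>l<Suc m. g (\<zeta> l) * c l)"
    using c[of "f m"] by simp
  also have "cmod \<dots> \<le> (\<Sum>l<Suc m. cmod (g (\<zeta> l)) * cmod (c l))"
    unfolding norm_mult[symmetric] by (rule norm_sum)
  \<comment> \<open>Each cofactor is a determinant of \<open>m\<close> points of \<open>K\<close>.
    Their number \<open>Suc m\<close> accumulates to the factorial in the upper bound.\<close>
  also have "\<dots> \<le> (\<Sum>l<Suc m. s * D)"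
  proof (rule sum_mono)
    fix l assume l: "l \<in> {..<Suc m}"
    have "cmod (c l) \<le> D"
      using assms(1) l by (subst c_norm) (auto intro!: D simp: insert_index_def)
    moreover have "cmod (g (\<zeta> l)) \<le> s" using s l assms(1) by auto
    moreover have "0 \<le> s" unfolding s_def g_def by (intro Sup_nonneg_nonneg bdd_above_comb)
    ultimately show "cmod (g (\<zeta> l)) * cmod (c l) \<le> s * D"
      by (intro mult_mono) auto
  qed
  finally show ?thesis by (simp add: s_def g_def algebra_simps)
qed

text \<open>For this induction \<open>fun_det_Suc_le\<close> is formulated with an arbitrary bound
  \<open>D\<close>: it is applied before the supremum \<open>max_det\<close> is known to be
  finite.\<close>

lemma bdd_above_fun_det: "bdd_above {cmod (fun_det f m \<zeta>) |\<zeta>. \<forall>l<m. \<zeta> l \<in> K}"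
proof (induction m)
  case 0
  then show ?case by (auto simp: fun_det_0)
next
  case (Suc m)
  then obtain D where "\<And>\<zeta>. \<forall>l<m. \<zeta> l \<in> K \<Longrightarrow> cmod (fun_det f m \<zeta>) \<le> D"
    by (auto simp: bdd_above_def)
  from fun_det_Suc_le[OF _ this] show ?case
    unfolding bdd_above_def by blast
qed

lemma max_det_nonneg: "0 \<le> max_det f K m"
  unfolding max_det_def by (intro Sup_nonneg_nonneg bdd_above_fun_det)

lemma max_det_upper: "\<forall>l<m. \<zeta> l \<in> K \<Longrightarrow> cmod (fun_det f m \<zeta>) \<le> max_det f K m"
  unfolding max_det_def by (intro Sup_nonneg_upper bdd_above_fun_det) auto

text \<open>The empty determinant is 1, and the condition on the points is vacuous, so this start of
  the inductions also covers \<open>K = {}\<close>.\<close>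

lemma max_det_0: "max_det f K 0 = 1"
  by (simp add: max_det_def Sup_nonneg_def fun_det_0 cSup_eq_Max)

text \<open>\<open>fun_det_Suc_le\<close> holds for every choice of coefficients, so the infimum
  over them may be taken. This is done after dividing by the factor in front, hence the separate
  case where that factor is 0.\<close>

lemma max_det_Suc_le: "max_det f K (Suc m) \<le> real (Suc m) * max_det f K m * min_norm f K m"
proof (cases "max_det f K m = 0")
  case True
  have "max_det f K (Suc m) \<le> 0"
    unfolding max_det_def[of _ _ "Suc m"]
  proof (rule Sup_nonneg_least)
    fix x assume "x \<in> {cmod (fun_det f (Suc m) \<zeta>) |\<zeta>. \<forall>l<Suc m. \<zeta> l \<in> K}"
    then obtain \<zeta> where x: "x = cmod (fun_det f (Suc m) \<zeta>)" and \<zeta>: "\<forall>l<Suc m. \<zeta> l \<in> K"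
      by auto
    show "x \<le> 0"
      unfolding x using fun_det_Suc_le[OF \<zeta> max_det_upper] True by simp
  qed simp
  then show ?thesis using True by simp
next
  case False
  then have pos: "0 < real (Suc m) * max_det f K m"
    using max_det_nonneg[of m] by auto
  have "max_det f K (Suc m) / (real (Suc m) * max_det f K m) \<le> min_norm f K m"
    unfolding min_norm_def
  proof (rule cINF_greatest)
    fix a
    define s where "s = Sup_nonneg ((\<lambda>z. cmod (f m z + (\<Sum>i<m. a i * f i z))) ` K)"
    have "0 \<le> s" unfolding s_def by (intro Sup_nonneg_nonneg bdd_above_comb)
    then have "max_det f K (Suc m) \<le> real (Suc m) * max_det f K m * s"
      unfolding max_det_def[of _ _ "Suc m"]
      by (intro Sup_nonneg_least)
        (use fun_det_Suc_le[OF _ max_det_upper] pos in \<open>auto simp: s_def\<close>)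
    then show "max_det f K (Suc m) / (real (Suc m) * max_det f K m) \<le> s"
      using pos by (simp add: pos_divide_le_eq mult.commute)
  qed simp
  then show ?thesis
    using pos by (simp add: pos_divide_le_eq mult.commute)
qed

text \<open>As a function of its last point, the determinant is a multiple of a monic combination.\<close>

lemma max_det_Suc_ge: "max_det f K m * min_norm f K m \<le> max_det f K (Suc m)"
proof -
  have *: "cmod (fun_det f m \<zeta>) * min_norm f K m \<le> max_det f K (Suc m)"
    if \<zeta>: "\<forall>l<m. \<zeta> l \<in> K" for \<zeta>
  proof (cases "fun_det f m \<zeta> = 0")
    case True
    then show ?thesis by (simp add: max_det_nonneg)
  next
    case False
    define \<Delta> where "\<Delta> = fun_det f m \<zeta>"
    obtain c where c: "\<And>z. fun_det f (Suc m) (\<zeta>(m := z)) = f m z * \<Delta> + (\<Sum>i<m. f i z * c i)"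
      unfolding \<Delta>_def
      using fun_det_expand_last_point[where f = f and \<zeta> = \<zeta> and m = m] by blast
    have eq: "\<Delta> * (f m z + (\<Sum>i<m. c i / \<Delta> * f i z)) = fun_det f (Suc m) (\<zeta>(m := z))" for z
      using False by (simp add: c \<Delta>_def[symmetric] distrib_left sum_distrib_left field_simps)
    define s where "s = Sup_nonneg ((\<lambda>z. cmod (f m z + (\<Sum>i<m. c i / \<Delta> * f i z))) ` K)"
    have "min_norm f K m \<le> s"
      unfolding min_norm_def s_def by (rule cINF_lower[OF bdd_below_comb]) simp
    also have "s \<le> max_det f K (Suc m) / cmod \<Delta>"
      unfolding s_def
    proof (rule Sup_nonneg_least)
      fix x assume "x \<in> (\<lambda>z. cmod (f m z + (\<Sum>i<m. c i / \<Delta> * f i z))) ` K"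
      then obtain z where z: "z \<in> K" "x = cmod (f m z + (\<Sum>i<m. c i / \<Delta> * f i z))" by auto
      have "cmod \<Delta> * x = cmod (fun_det f (Suc m) (\<zeta>(m := z)))"
        unfolding z eq[symmetric] norm_mult ..
      also have "\<dots> \<le> max_det f K (Suc m)"
        using \<zeta> z by (intro max_det_upper) (auto simp: less_Suc_eq)
      finally show "x \<le> max_det f K (Suc m) / cmod \<Delta>"
        using False by (simp add: \<Delta>_def pos_le_divide_eq mult.commute)
    qed (simp add: max_det_nonneg)
    finally show ?thesis
      using False by (simp add: \<Delta>_def pos_le_divide_eq mult.commute)
  qed
  show ?thesis
  proof (cases "min_norm f K m = 0")
    case True
    then show ?thesis by (simp add: max_det_nonneg)
  next
    case False
    then have pos: "0 < min_norm f K m" using min_norm_nonneg[of m] by simp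
    have "max_det f K m \<le> max_det f K (Suc m) / min_norm f K m"
      unfolding max_det_def[of _ _ m]
      by (rule Sup_nonneg_least) (use * pos max_det_nonneg in \<open>auto simp: pos_le_divide_eq\<close>)
    then show ?thesis using pos by (simp add: pos_le_divide_eq)
  qed
qed

lemma prod_min_norm_le_max_det: "(\<Prod>i<m. min_norm f K i) \<le> max_det f K m"
proof (induction m)
  case (Suc m)
  have "(\<Prod>i<Suc m. min_norm f K i) \<le> max_det f K m * min_norm f K m"
    using Suc min_norm_nonneg by (simp add: mult_right_mono)
  also note max_det_Suc_ge
  finally show ?case .
qed (simp add: max_det_0)

lemma max_det_le_prod_min_norm: "max_det f K m \<le> fact m * (\<Prod>i<m. min_norm f K i)"
proof (induction m)
  case (Suc m)
  have "max_det f K (Suc m) \<le> real (Suc m) * max_det f K m * min_norm f K m"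
    by (rule max_det_Suc_le)
  also have "\<dots> \<le> real (Suc m) * (fact m * (\<Prod>i<m. min_norm f K i)) * min_norm f K m"
    using Suc min_norm_nonneg by (intro mult_right_mono mult_left_mono) auto
  finally show ?case by (simp add: algebra_simps)
qed (simp add: max_det_0)

end

text \<open>Permuting rows only changes the sign. A prescribed enumeration of the exponents can thus
  be traded for one that increases along \<open>prec\<close>, the only kind for which
  \<open>min_norm\<close> is a Chebyshev quantity.\<close>

lemma max_det_permute:
  assumes "p permutes {0..<m}"
  shows "max_det (\<lambda>i. f (p i)) K m = max_det f K m"
proof -
  have "cmod (fun_det (\<lambda>i. f (p i)) m \<zeta>) = cmod (fun_det f m \<zeta>)" for \<zeta>
  proof -
    define A where "A = Matrix.mat m m (\<lambda>(i, l). f i (\<zeta> l))"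
    have p: "p i < m" if "i < m" for i
      using permutes_in_image[OF assms, of i] that by simp
    have "Matrix.mat m m (\<lambda>(i, l). f (p i) (\<zeta> l)) = Matrix.mat m m (\<lambda>(i, l). A $$ (p i, l))"
      by (rule eq_matI) (simp_all add: A_def p)
    then have "fun_det (\<lambda>i. f (p i)) m \<zeta> = signof p * fun_det f m \<zeta>"
      unfolding fun_det_def using Determinant.det_permute_rows[OF _ assms, of A]
      by (simp add: A_def)
    then show ?thesis by (simp add: norm_mult sign_def)
  qed
  then show ?thesis unfolding max_det_def by simp
qed

section \<open>Weighted polynomials with exponents in a convex body\<close>

lemma finite_vec_le: "finite {\<alpha> :: nat ^ 'n::finite. \<forall>i. \<alpha> $ i \<le> b}"
proof (rule finite_subset)
  show "{\<alpha> :: nat ^ 'n. \<forall>i. \<alpha> $ i \<le> b} \<subseteq> vec_lambda ` PiE UNIV (\<lambda>_. {..b})"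
    by (auto intro!: image_eqI[where x = "vec_nth _"] simp: vec_nth_inverse)
  show "finite (vec_lambda ` PiE UNIV (\<lambda>_. {..b}) :: (nat ^ 'n) set)"
    by (intro finite_imageI finite_PiE) auto
qed

lemma real_vec_add: "real_vec (\<alpha> + \<beta>) = real_vec \<alpha> + real_vec \<beta>"
  by (simp add: real_vec_def vec_eq_iff)

lemma real_vec_scale: "real_vec (q *s \<alpha>) = real q *\<^sub>R real_vec \<alpha>"
  by (simp add: real_vec_def vec_eq_iff)

lemma mdeg_add: "mdeg (\<alpha> + \<beta>) = mdeg \<alpha> + mdeg \<beta>"
  by (simp add: mdeg_def sum.distrib)

lemma component_le_mdeg: "\<alpha> $ i \<le> mdeg \<alpha>"
  unfolding mdeg_def by (rule member_le_sum) auto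

section \<open>The graded lexicographic order of exponents\<close>

lemma prec_irrefl: "\<not> prec \<alpha> \<alpha>"
  by (auto simp: prec_def)

lemma prec_trans: "prec \<alpha> \<beta> \<Longrightarrow> prec \<beta> \<gamma> \<Longrightarrow> prec \<alpha> \<gamma>"
proof -
  assume *: "prec \<alpha> \<beta>" "prec \<beta> \<gamma>"
  show ?thesis
  proof (cases "mdeg \<alpha> = mdeg \<beta> \<and> mdeg \<beta> = mdeg \<gamma>")
    case True
    then obtain m m' where m: "\<alpha> $ m < \<beta> $ m" "\<forall>j<m. \<alpha> $ j = \<beta> $ j"
      and m': "\<beta> $ m' < \<gamma> $ m'" "\<forall>j<m'. \<beta> $ j = \<gamma> $ j"
      using * by (auto simp: prec_def)
    have "\<alpha> $ min m m' < \<gamma> $ min m m' \<and> (\<forall>j<min m m'. \<alpha> $ j = \<gamma> $ j)"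
      using m m' by (cases m m' rule: linorder_cases) (auto simp: min_def)
    then show ?thesis using True by (auto simp: prec_def)
  qed (use * in \<open>auto simp: prec_def\<close>)
qed

lemma prec_total: "\<alpha> \<noteq> \<beta> \<Longrightarrow> prec \<alpha> \<beta> \<or> prec \<beta> \<alpha>"
proof (cases "mdeg \<alpha> = mdeg \<beta>")
  case True
  assume "\<alpha> \<noteq> \<beta>"
  then have ne: "{i. \<alpha> $ i \<noteq> \<beta> $ i} \<noteq> {}" by (auto simp: vec_eq_iff)
  define m where "m = Min {i. \<alpha> $ i \<noteq> \<beta> $ i}"
  have "\<alpha> $ m \<noteq> \<beta> $ m" using Min_in[OF _ ne] by (simp add: m_def)
  moreover have "\<alpha> $ j = \<beta> $ j" if "j < m" for j
    using Min_le[of "{i. \<alpha> $ i \<noteq> \<beta> $ i}" j] that unfolding m_def[symmetric] by fastforce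
  ultimately show ?thesis
    using True unfolding prec_def by (metis linorder_neq_iff)
qed (auto simp: prec_def)

text \<open>Translation invariance is the property of the order that makes a product of monic
  polynomials monic again.\<close>

lemma prec_add_left: "prec \<beta> \<gamma> \<Longrightarrow> prec (\<alpha> + \<beta>) (\<alpha> + \<gamma>)"
  by (auto simp: prec_def mdeg_add)

lemma finite_prec_enumeration:
  assumes "finite (S :: (nat ^ 'n::{finite,linorder}) set)"
  obtains s where "bij_betw s {..<card S} S"
    "\<And>i j. i < j \<Longrightarrow> j < card S \<Longrightarrow> prec (s i) (s j)"
proof -
  \<comment> \<open>Interpreting the order locally gives access to sorted lists with respect to
    \<open>prec\<close>, whatever other order the vectors may carry.\<close>
  interpret P: linorder "\<lambda>\<alpha> \<beta> :: nat ^ 'n::{finite,linorder}. prec \<alpha> \<beta> \<or> \<alpha> = \<beta>" prec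
    by standard (use prec_irrefl prec_trans prec_total in blast)+
  define s where "s = (!) (P.sorted_list_of_set S)"
  have len: "length (P.sorted_list_of_set S) = card S"
    using assms by simp
  have "sorted_wrt prec (P.sorted_list_of_set S)"
    using P.strict_sorted_list_of_set[of S] by simp
  then have "prec (s i) (s j)" if "i < j" "j < card S" for i j
    using that len unfolding s_def by (simp add: sorted_wrt_iff_nth_less)
  moreover have "bij_betw s {..<card S} S"
    unfolding s_def by (rule bij_betw_nth) (use assms len in auto)
  ultimately show ?thesis using that by blast
qed

section \<open>Spans of monomials and monic polynomials\<close>

lemma monomial_add: "monomial (\<alpha> + \<beta>) z = monomial \<alpha> z * monomial \<beta> z"
  by (simp add: monomial_def power_add prod.distrib)

lemma continuous_on_monomial [continuous_intros]: "continuous_on S (monomial \<alpha>)"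
  unfolding monomial_def[abs_def] by (intro continuous_intros)

definition poly_span :: "(nat ^ 'n::finite) set \<Rightarrow> (complex ^ 'n \<Rightarrow> complex) set" where
  "poly_span S = {\<lambda>z. \<Sum>\<beta>\<in>S. a \<beta> * monomial \<beta> z |a. True}"

lemma poly_spanI: "(\<lambda>z. \<Sum>\<beta>\<in>S. a \<beta> * monomial \<beta> z) \<in> poly_span S"
  unfolding poly_span_def by (rule CollectI, rule exI[of _ a]) simp

lemma poly_spanE:
  assumes "f \<in> poly_span S"
  obtains a where "f = (\<lambda>z. \<Sum>\<beta>\<in>S. a \<beta> * monomial \<beta> z)"
  using assms unfolding poly_span_def by (elim CollectE exE conjE)

lemma monic_polysI:
  "g \<in> poly_span {\<beta>\<in>lattice_pts C k. prec \<beta> \<alpha>} \<Longrightarrow> (\<lambda>z. monomial \<alpha> z + g z) \<in> monic_polys C k \<alpha>"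
  unfolding monic_polys_def by (erule poly_spanE, rule CollectI, rule exI) simp

lemma monic_polysE:
  assumes "p \<in> monic_polys C k \<alpha>"
  obtains g where "g \<in> poly_span {\<beta>\<in>lattice_pts C k. prec \<beta> \<alpha>}" "p = (\<lambda>z. monomial \<alpha> z + g z)"
proof -
  obtain a where a: "p = (\<lambda>z. monomial \<alpha> z + (\<Sum>\<beta>\<in>{\<beta>\<in>lattice_pts C k. prec \<beta> \<alpha>}. a \<beta> * monomial \<beta> z))"
    using assms unfolding monic_polys_def by (elim CollectE exE conjE)
  show ?thesis by (rule that[OF poly_spanI a])
qed

lemma poly_span_add:
  assumes "f \<in> poly_span S" "g \<in> poly_span S"
  shows "(\<lambda>z. f z + g z) \<in> poly_span S"
proof -
  obtain a where a: "f = (\<lambda>z. \<Sum>\<beta>\<in>S. a \<beta> * monomial \<beta> z)"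
    by (rule poly_spanE[OF assms(1)])
  obtain b where b: "g = (\<lambda>z. \<Sum>\<beta>\<in>S. b \<beta> * monomial \<beta> z)"
    by (rule poly_spanE[OF assms(2)])
  have "(\<lambda>z. f z + g z) = (\<lambda>z. \<Sum>\<beta>\<in>S. (a \<beta> + b \<beta>) * monomial \<beta> z)"
    unfolding a b by (simp add: sum.distrib distrib_right)
  then show ?thesis by (simp add: poly_spanI)
qed

lemma poly_span_0: "(\<lambda>_. 0) \<in> poly_span S"
  using poly_spanI[of "\<lambda>_. 0" S] by simp

lemma poly_span_sum:
  "(\<And>i. i \<in> I \<Longrightarrow> f i \<in> poly_span S) \<Longrightarrow> (\<lambda>z. \<Sum>i\<in>I. f i z) \<in> poly_span S"
proof (induction I rule: infinite_finite_induct)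
  case (insert i I)
  then show ?case by (simp add: poly_span_add)
qed (auto simp: poly_span_0)

lemma poly_span_monomial:
  assumes "finite S" "\<beta> \<in> S"
  shows "(\<lambda>z. c * monomial \<beta> z) \<in> poly_span S"
proof -
  have "(\<lambda>z. c * monomial \<beta> z) = (\<lambda>z. \<Sum>\<gamma>\<in>S. (if \<gamma> = \<beta> then c else 0) * monomial \<gamma> z)"
    using assms by (simp add: if_distrib[of "\<lambda>x. x * _"] cong: if_cong)
  then show ?thesis by (simp only: poly_spanI)
qed

lemma poly_span_mult:
  assumes "finite U" "\<And>\<beta> \<gamma>. \<beta> \<in> S \<Longrightarrow> \<gamma> \<in> T \<Longrightarrow> \<beta> + \<gamma> \<in> U"
    and "f \<in> poly_span S" "g \<in> poly_span T"
  shows "(\<lambda>z. f z * g z) \<in> poly_span U"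
proof -
  obtain a where a: "f = (\<lambda>z. \<Sum>\<beta>\<in>S. a \<beta> * monomial \<beta> z)"
    by (rule poly_spanE[OF assms(3)])
  obtain b where b: "g = (\<lambda>z. \<Sum>\<beta>\<in>T. b \<beta> * monomial \<beta> z)"
    by (rule poly_spanE[OF assms(4)])
  have "(\<lambda>z. f z * g z) = (\<lambda>z. \<Sum>\<beta>\<in>S. \<Sum>\<gamma>\<in>T. a \<beta> * b \<gamma> * monomial (\<beta> + \<gamma>) z)"
    unfolding a b by (simp add: sum_product monomial_add algebra_simps)
  also have "\<dots> \<in> poly_span U"
    using assms by (intro poly_span_sum poly_span_monomial)
  finally show ?thesis .
qed

lemma poly_span_continuous: "f \<in> poly_span S \<Longrightarrow> continuous_on A f"
  by (erule poly_spanE) (auto intro!: continuous_intros)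

lemma monic_polys_continuous: "p \<in> monic_polys C k \<alpha> \<Longrightarrow> continuous_on A p"
  by (erule monic_polysE) (simp add: continuous_on_add continuous_on_monomial poly_span_continuous)

lemma monomial_in_monic_polys: "monomial \<alpha> \<in> monic_polys C k \<alpha>"
  using monic_polysI[OF poly_span_0] by simp

text \<open>The infima are taken one factor at a time, by division. For \<open>t \<le> 0\<close> the
  claim is trivial; for \<open>t > 0\<close> the hypothesis forces every element of
  \<open>A\<close>, and then \<open>Inf B\<close>, to be positive, so both divisions are
  legitimate.\<close>

lemma le_Inf_mult:
  fixes A B :: "real set"
  assumes "A \<noteq> {}" "B \<noteq> {}" "\<And>x. x \<in> A \<Longrightarrow> 0 \<le> x" "\<And>y. y \<in> B \<Longrightarrow> 0 \<le> y"
    and le: "\<And>x y. x \<in> A \<Longrightarrow> y \<in> B \<Longrightarrow> t \<le> x * y"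
  shows "t \<le> Inf A * Inf B"
proof (cases "t \<le> 0")
  case True
  moreover have "0 \<le> Inf A" "0 \<le> Inf B" using assms by (auto intro!: cInf_greatest)
  ultimately show ?thesis by (meson mult_nonneg_nonneg order_trans)
next
  case False
  have pos: "0 < x" if "x \<in> A" for x
    using that assms(2,3) le False by (metis equals0I less_eq_real_def mult_zero_left)
  have 1: "t / x \<le> Inf B" if "x \<in> A" for x
  proof (rule cInf_greatest[OF assms(2)])
    fix y assume "y \<in> B"
    then show "t / x \<le> y"
      using le[OF that, of y] pos[OF that] by (simp add: pos_divide_le_eq mult.commute)
  qed
  obtain x0 where "x0 \<in> A" using assms by auto
  have "0 < t / x0" using False pos[OF \<open>x0 \<in> A\<close>] by simp
  then have B: "0 < Inf B" using 1[OF \<open>x0 \<in> A\<close>] by linarith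
  have "t / Inf B \<le> Inf A"
  proof (rule cInf_greatest[OF assms(1)])
    fix x assume "x \<in> A"
    from 1[OF this] show "t / Inf B \<le> x"
      using pos[OF \<open>x \<in> A\<close>] B by (simp add: field_simps)
  qed
  then show ?thesis using B by (simp add: field_simps)
qed

section \<open>Lattice points in the dilates of a convex body\<close>

locale lattice_body =
  fixes C :: "(real ^ 'n::{finite,linorder}) set"
  assumes nonneg_C: "C \<subseteq> {x. \<forall>i. 0 \<le> x $ i}"
    and compact_C: "compact C" and convex_C: "convex C"
    and simplex_C: "std_simplex \<subseteq> C"
begin

lemma lattice_pts_iff: "1 \<le> k \<Longrightarrow> \<alpha> \<in> lattice_pts C k \<longleftrightarrow> (1 / real k) *\<^sub>R real_vec \<alpha> \<in> C"
  unfolding lattice_pts_def by (auto simp: image_iff intro: bexI[rotated])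

text \<open>The point \<open>(\<alpha> + \<beta>)/(k + l)\<close> is the convex combination of
  \<open>\<alpha>/k\<close> and \<open>\<beta>/l\<close> with weights \<open>k/(k+l)\<close> and
  \<open>l/(k+l)\<close>.\<close>

lemma lattice_pts_add:
  assumes "1 \<le> k" "1 \<le> l" "\<alpha> \<in> lattice_pts C k" "\<beta> \<in> lattice_pts C l"
  shows "\<alpha> + \<beta> \<in> lattice_pts C (k + l)"
proof -
  have "(real k / real (k + l)) *\<^sub>R ((1 / real k) *\<^sub>R real_vec \<alpha>) +
      (real l / real (k + l)) *\<^sub>R ((1 / real l) *\<^sub>R real_vec \<beta>) \<in> C"
    using assms by (intro convexD[OF convex_C])
      (auto simp: lattice_pts_iff add_divide_distrib[symmetric])
  also have "(real k / real (k + l)) *\<^sub>R ((1 / real k) *\<^sub>R real_vec \<alpha>) +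
      (real l / real (k + l)) *\<^sub>R ((1 / real l) *\<^sub>R real_vec \<beta>) =
      (1 / real (k + l)) *\<^sub>R real_vec (\<alpha> + \<beta>)"
    using assms by (simp add: real_vec_add scaleR_add_right)
  finally show ?thesis using assms by (subst lattice_pts_iff) auto
qed

lemma lattice_pts_scale:
  assumes "1 \<le> k" "1 \<le> q" "\<alpha> \<in> lattice_pts C k"
  shows "q *s \<alpha> \<in> lattice_pts C (q * k)"
proof -
  have "(1 / real (q * k)) *\<^sub>R real_vec (q *s \<alpha>) = (1 / real k) *\<^sub>R real_vec \<alpha>"
    using assms by (simp add: real_vec_scale)
  then show ?thesis using assms by (simp add: lattice_pts_iff)
qed

lemma zero_in_C: "0 \<in> C"
  using simplex_C by (auto simp: std_simplex_def)

lemma zero_in_lattice_pts: "0 \<in> lattice_pts C k"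
  unfolding lattice_pts_def using zero_in_C
  by (auto simp: real_vec_def vec_eq_iff intro!: image_eqI[where x = 0])

lemma mdeg_bound: "\<exists>R. \<forall>k\<ge>1. \<forall>\<alpha>\<in>lattice_pts C k. mdeg \<alpha> \<le> k * R"
proof -
  obtain b where b: "\<And>x. x \<in> C \<Longrightarrow> norm x \<le> b"
    using compact_imp_bounded[OF compact_C] by (auto simp: bounded_iff)
  define R where "R = nat \<lceil>real CARD('n) * b\<rceil>"
  have "mdeg \<alpha> \<le> k * R" if "1 \<le> k" "\<alpha> \<in> lattice_pts C k" for k \<alpha>
  proof -
    define x where "x = (1 / real k) *\<^sub>R real_vec \<alpha>"
    have "x \<in> C" using that lattice_pts_iff by (simp add: x_def)
    have "real (mdeg \<alpha>) = real k * (\<Sum>i\<in>UNIV. x $ i)"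
      using that by (simp add: x_def real_vec_def mdeg_def sum_divide_distrib[symmetric])
    also have "(\<Sum>i\<in>UNIV. x $ i) \<le> (\<Sum>i\<in>(UNIV :: 'n set). b)"
      using b[OF \<open>x \<in> C\<close>] component_le_norm_cart[of x] by (intro sum_mono) (smt (verit))
    also have "\<dots> \<le> real R" unfolding R_def by (simp; linarith)
    finally have "real (mdeg \<alpha>) \<le> real (k * R)"
      by (simp add: mult_left_mono)
    then show ?thesis by linarith
  qed
  then show ?thesis by blast
qed

lemma finite_lattice_pts: "1 \<le> k \<Longrightarrow> finite (lattice_pts C k)"
proof -
  assume "1 \<le> k"
  obtain R where "\<forall>k\<ge>1. \<forall>\<alpha>\<in>lattice_pts C k. mdeg \<alpha> \<le> k * R"
    using mdeg_bound by auto
  then have "lattice_pts C k \<subseteq> {\<alpha>. \<forall>i. \<alpha> $ i \<le> k * R}"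
    using \<open>1 \<le> k\<close> component_le_mdeg order_trans by blast
  then show ?thesis using finite_vec_le finite_subset by blast
qed

lemma num_pts_pos: "1 \<le> k \<Longrightarrow> 0 < num_pts C k"
  unfolding num_pts_def using finite_lattice_pts zero_in_lattice_pts by (auto simp: card_gt_0_iff)

text \<open>Besides the leading monomial the product has three parts. Convexity keeps their
  exponents in the dilate \<open>k + l\<close>, and translation invariance of \<open>prec\<close>
  keeps them below \<open>\<alpha> + \<beta>\<close>; for the product of the two tails this takes
  two comparisons, through \<open>\<gamma> + \<beta>\<close>.\<close>

lemma monic_polys_mult:
  assumes kl: "1 \<le> k" "1 \<le> l" and \<alpha>: "\<alpha> \<in> lattice_pts C k" and \<beta>: "\<beta> \<in> lattice_pts C l"
    and p: "p \<in> monic_polys C k \<alpha>" and q: "q \<in> monic_polys C l \<beta>"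
  shows "(\<lambda>z. p z * q z) \<in> monic_polys C (k + l) (\<alpha> + \<beta>)"
proof -
  let ?S = "{\<gamma> \<in> lattice_pts C k. prec \<gamma> \<alpha>}" and ?T = "{\<gamma> \<in> lattice_pts C l. prec \<gamma> \<beta>}"
    and ?U = "{\<gamma> \<in> lattice_pts C (k + l). prec \<gamma> (\<alpha> + \<beta>)}"
  obtain g where g: "g \<in> poly_span ?S" "p = (\<lambda>z. monomial \<alpha> z + g z)"
    by (rule monic_polysE[OF p])
  obtain h where h: "h \<in> poly_span ?T" "q = (\<lambda>z. monomial \<beta> z + h z)"
    by (rule monic_polysE[OF q])
  have fin: "finite ?U" using finite_lattice_pts[of "k + l"] kl by auto
  have mono: "monomial \<gamma> \<in> poly_span {\<gamma>}" for \<gamma> :: "nat ^ 'n::{finite,linorder}"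
    using poly_span_monomial[of "{\<gamma>}" \<gamma> 1] by simp
  have 1: "(\<lambda>z. monomial \<alpha> z * h z) \<in> poly_span ?U"
    by (rule poly_span_mult[OF fin _ mono h(1)])
      (use kl \<alpha> in \<open>auto intro!: lattice_pts_add prec_add_left\<close>)
  have 2: "(\<lambda>z. g z * monomial \<beta> z) \<in> poly_span ?U"
  proof (rule poly_span_mult[OF fin _ g(1) mono])
    fix \<gamma> \<delta> assume "\<gamma> \<in> ?S" "\<delta> \<in> {\<beta>}"
    then show "\<gamma> + \<delta> \<in> ?U"
      using lattice_pts_add[OF kl _ \<beta>, of \<gamma>] prec_add_left[of \<gamma> \<alpha> \<beta>]
      by (simp add: add.commute)
  qed
  have 3: "(\<lambda>z. g z * h z) \<in> poly_span ?U"
  proof (rule poly_span_mult[OF fin _ g(1) h(1)])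
    fix \<gamma> \<delta> assume *: "\<gamma> \<in> ?S" "\<delta> \<in> ?T"
    have "prec (\<gamma> + \<delta>) (\<gamma> + \<beta>)" using * by (auto intro: prec_add_left)
    moreover have "prec (\<gamma> + \<beta>) (\<alpha> + \<beta>)"
      using * prec_add_left[of \<gamma> \<alpha> \<beta>] by (simp add: add.commute)
    ultimately show "\<gamma> + \<delta> \<in> ?U"
      using * kl by (auto intro: lattice_pts_add prec_trans)
  qed
  have "(\<lambda>z. p z * q z) =
      (\<lambda>z. monomial (\<alpha> + \<beta>) z + (monomial \<alpha> z * h z + (g z * monomial \<beta> z + g z * h z)))"
    by (simp add: g h monomial_add algebra_simps)
  then show ?thesis
    using monic_polysI[OF poly_span_add[OF 1 poly_span_add[OF 2 3]]] by simp
qed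

end

section \<open>Minimal weighted norms of monic polynomials\<close>

definition min_weighted ::
  "(real ^ 'n::{finite,linorder}) set \<Rightarrow> (complex ^ 'n::{finite,linorder}) set
    \<Rightarrow> (complex ^ 'n::{finite,linorder} \<Rightarrow> real) \<Rightarrow> nat \<Rightarrow> nat ^ 'n::{finite,linorder} \<Rightarrow> real" where
  "min_weighted C K w k \<alpha> = Inf (weighted_norm K w k ` monic_polys C k \<alpha>)"

locale weighted_body = lattice_body C
  for C :: "(real ^ 'n::{finite,linorder}) set" +
  fixes K :: "(complex ^ 'n::{finite,linorder}) set"
    and w :: "complex ^ 'n::{finite,linorder} \<Rightarrow> real"
  assumes compact_K: "compact K" and cont_w: "continuous_on K w"
    and w_nonneg: "\<And>z. z \<in> K \<Longrightarrow> 0 \<le> w z"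
begin

lemma bounded_weighted:
  assumes "continuous_on K p"
  shows "bounded ((\<lambda>z. of_real (w z) ^ k * p z :: complex) ` K)"
  by (intro compact_imp_bounded compact_continuous_image compact_K continuous_intros cont_w assms)

lemma bdd_weighted:
  assumes "continuous_on K p"
  shows "bdd_above ((\<lambda>z. cmod (of_real (w z) ^ k * p z)) ` K)"
  using bounded_weighted[OF assms, of k] by (auto simp: bounded_iff bdd_above_def)

lemma weighted_norm_nonneg: "continuous_on K p \<Longrightarrow> 0 \<le> weighted_norm K w k p"
  unfolding weighted_norm_def by (intro Sup_nonneg_nonneg bdd_weighted)

lemma weighted_norm_upper:
  "continuous_on K p \<Longrightarrow> z \<in> K \<Longrightarrow> cmod (of_real (w z) ^ k * p z) \<le> weighted_norm K w k p"
  unfolding weighted_norm_def by (intro Sup_nonneg_upper bdd_weighted) auto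

lemma min_weighted_nonneg: "0 \<le> min_weighted C K w k \<alpha>"
  unfolding min_weighted_def using monomial_in_monic_polys
  by (intro cInf_greatest) (auto intro!: weighted_norm_nonneg monic_polys_continuous)

lemma min_weighted_le: "p \<in> monic_polys C k \<alpha> \<Longrightarrow> min_weighted C K w k \<alpha> \<le> weighted_norm K w k p"
  unfolding min_weighted_def
  by (intro cInf_lower bdd_belowI[of _ 0])
    (auto intro!: weighted_norm_nonneg monic_polys_continuous)

text \<open>Products of competitors for \<open>\<alpha>\<close> and \<open>\<beta>\<close> compete
  for \<open>\<alpha> + \<beta>\<close>, and since the weight enters as \<open>w ^ k\<close>, its
  powers split in the same way as the polynomials.\<close>

lemma min_weighted_add:
  assumes "1 \<le> k" "1 \<le> l" "\<alpha> \<in> lattice_pts C k" "\<beta> \<in> lattice_pts C l"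
  shows "min_weighted C K w (k + l) (\<alpha> + \<beta>) \<le> min_weighted C K w k \<alpha> * min_weighted C K w l \<beta>"
  unfolding min_weighted_def[of _ _ _ k] min_weighted_def[of _ _ _ l]
proof (rule le_Inf_mult)
  fix x y assume "x \<in> weighted_norm K w k ` monic_polys C k \<alpha>" "y \<in> weighted_norm K w l ` monic_polys C l \<beta>"
  then obtain p q where p: "p \<in> monic_polys C k \<alpha>" "x = weighted_norm K w k p"
    and q: "q \<in> monic_polys C l \<beta>" "y = weighted_norm K w l q" by auto
  have cont: "continuous_on K p" "continuous_on K q"
    using p q by (auto intro: monic_polys_continuous)
  have "min_weighted C K w (k + l) (\<alpha> + \<beta>) \<le> weighted_norm K w (k + l) (\<lambda>z. p z * q z)"
    using assms p q by (intro min_weighted_le monic_polys_mult)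
  also have "\<dots> \<le> x * y"
    unfolding weighted_norm_def[of _ _ "k + l"]
  proof (rule Sup_nonneg_least)
    fix v assume "v \<in> (\<lambda>z. cmod (of_real (w z) ^ (k + l) * (p z * q z))) ` K"
    then obtain z where z: "z \<in> K" and
      "v = cmod (of_real (w z) ^ k * p z) * cmod (of_real (w z) ^ l * q z)"
      by (auto simp: norm_mult power_add)
    then show "v \<le> x * y"
      unfolding p q using cont by (auto intro!: mult_mono weighted_norm_upper weighted_norm_nonneg)
  qed (use cont in \<open>auto simp: p q intro!: mult_nonneg_nonneg weighted_norm_nonneg\<close>)
  finally show "min_weighted C K w (k + l) (\<alpha> + \<beta>) \<le> x * y" .
qed (use monomial_in_monic_polys in \<open>auto intro!: weighted_norm_nonneg monic_polys_continuous\<close>)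

lemma min_weighted_bound:
  "\<exists>B\<ge>1. \<forall>k\<ge>1. \<forall>\<alpha>\<in>lattice_pts C k. min_weighted C K w k \<alpha> \<le> B ^ k"
proof -
  obtain R where R: "\<forall>k\<ge>1. \<forall>\<alpha>\<in>lattice_pts C k. mdeg \<alpha> \<le> k * R"
    using mdeg_bound by auto
  obtain W where "\<forall>x\<in>w ` K. norm x \<le> W"
    using compact_imp_bounded[OF compact_continuous_image[OF cont_w compact_K]]
    unfolding bounded_iff by blast
  then have W: "\<And>z. z \<in> K \<Longrightarrow> w z \<le> W" by auto
  obtain Z0 where Z0: "\<And>z. z \<in> K \<Longrightarrow> norm z \<le> Z0"
    using compact_imp_bounded[OF compact_K] by (auto simp: bounded_iff)
  \<comment> \<open>The competitor is the monomial itself. With \<open>Z \<ge> 1\<close> the degree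
    bound \<open>mdeg \<alpha> \<le> k * R\<close> may be used in the exponent, so that
    \<open>Z ^ R\<close> and the bound on the weight combine to a pure k-th power.\<close>
  define Z where "Z = max 1 Z0"
  define B where "B = max 1 W * Z ^ R"
  have Z1: "1 \<le> Z" by (simp add: Z_def)
  have "min_weighted C K w k \<alpha> \<le> B ^ k" if k: "1 \<le> k" and \<alpha>: "\<alpha> \<in> lattice_pts C k" for k \<alpha>
  proof -
    have "min_weighted C K w k \<alpha> \<le> weighted_norm K w k (monomial \<alpha>)"
      by (intro min_weighted_le monomial_in_monic_polys)
    also have "\<dots> \<le> B ^ k"
      unfolding weighted_norm_def
    proof (rule Sup_nonneg_least)
      fix v assume "v \<in> (\<lambda>z. cmod (of_real (w z) ^ k * monomial \<alpha> z)) ` K"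
      then obtain z where z: "z \<in> K" and v: "v = w z ^ k * cmod (monomial \<alpha> z)"
        using w_nonneg by (auto simp: norm_mult norm_power)
      have "cmod (monomial \<alpha> z) \<le> (\<Prod>i\<in>UNIV. Z ^ (\<alpha> $ i))"
        unfolding monomial_def prod_norm[symmetric] norm_power
      proof (intro prod_mono conjI power_mono)
        fix i
        show "cmod (z $ i) \<le> Z"
          using Z0[OF z] Finite_Cartesian_Product.norm_nth_le[of z i] by (simp add: Z_def)
      qed auto
      also have "\<dots> = Z ^ mdeg \<alpha>" by (simp add: mdeg_def power_sum)
      also have "\<dots> \<le> Z ^ (R * k)"
        using R k \<alpha> Z1 by (intro power_increasing) (auto simp: mult.commute)
      finally have "v \<le> max 1 W ^ k * Z ^ (R * k)"
        unfolding v using W[OF z] w_nonneg[OF z] by (intro mult_mono power_mono) auto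
      then show "v \<le> B ^ k" by (simp add: B_def power_mult_distrib power_mult)
    qed (use Z1 in \<open>auto simp: B_def\<close>)
    finally show ?thesis .
  qed
  moreover have "1 \<le> B"
    using mult_mono[of 1 "max 1 W" 1 "Z ^ R"] Z1 by (simp add: B_def)
  ultimately show ?thesis by blast
qed

text \<open>In an increasing enumeration the exponents below \<open>s m\<close> are exactly
  \<open>s 0, ..., s (m - 1)\<close>, so monic combinations of the first functions are the weighted
  monic polynomials. The weight factor \<open>w ^ k\<close> is common to all terms.\<close>

lemma min_norm_enumeration:
  assumes k: "1 \<le> k" and s: "bij_betw s {..<num_pts C k} (lattice_pts C k)"
    and mono: "\<And>i j. i < j \<Longrightarrow> j < num_pts C k \<Longrightarrow> prec (s i) (s j)"
    and m: "m < num_pts C k"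
  shows "min_norm (\<lambda>i z. of_real (w z) ^ k * monomial (s i) z) K m = min_weighted C K w k (s m)"
proof -
  have inj: "inj_on s {..<m}"
    using s m by (auto simp: bij_betw_def intro: inj_on_subset)
  have S: "{\<beta> \<in> lattice_pts C k. prec \<beta> (s m)} = s ` {..<m}"
  proof safe
    fix \<beta> assume "\<beta> \<in> lattice_pts C k" "prec \<beta> (s m)"
    then obtain i where i: "\<beta> = s i" "i < num_pts C k" using s by (auto simp: bij_betw_def)
    then have "i < m"
      using mono[of m i] \<open>prec \<beta> (s m)\<close> prec_trans prec_irrefl by (metis linorder_cases)
    then show "\<beta> \<in> s ` {..<m}" using i by auto
  qed (use s m mono in \<open>auto simp: bij_betw_def\<close>)
  have eq: "monic_polys C k (s m) = range (\<lambda>a z. monomial (s m) z + (\<Sum>i<m. a i * monomial (s i) z))"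
  proof (intro equalityI subsetI)
    fix p assume "p \<in> monic_polys C k (s m)"
    then obtain g where g: "g \<in> poly_span (s ` {..<m})" and p: "p = (\<lambda>z. monomial (s m) z + g z)"
      unfolding S[symmetric] by (rule monic_polysE)
    obtain a where "g = (\<lambda>z. \<Sum>\<beta>\<in>s ` {..<m}. a \<beta> * monomial \<beta> z)"
      by (rule poly_spanE[OF g])
    then have "p = (\<lambda>z. monomial (s m) z + (\<Sum>i<m. a (s i) * monomial (s i) z))"
      by (simp add: p sum.reindex[OF inj])
    then show "p \<in> range (\<lambda>a z. monomial (s m) z + (\<Sum>i<m. a i * monomial (s i) z))"
      by (rule range_eqI[where x = "\<lambda>i. a (s i)"])
  next
    fix p assume "p \<in> range (\<lambda>a z. monomial (s m) z + (\<Sum>i<m. a i * monomial (s i) z))"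
    then obtain a where "p = (\<lambda>z. monomial (s m) z + (\<Sum>i<m. a i * monomial (s i) z))"
      by (rule rangeE)
    also have "\<dots> = (\<lambda>z. monomial (s m) z + (\<Sum>\<beta>\<in>s ` {..<m}. a (inv_into {..<m} s \<beta>) * monomial \<beta> z))"
      by (simp add: sum.reindex[OF inj] inv_into_f_f[OF inj])
    finally show "p \<in> monic_polys C k (s m)"
      by (simp only: monic_polysI S poly_spanI)
  qed
  show ?thesis
    unfolding min_norm_def min_weighted_def eq image_image weighted_norm_def
    by (simp add: distrib_left sum_distrib_left algebra_simps)
qed

lemma vandermonde_bounds:
  assumes k: "1 \<le> k" and e: "bij_betw (e k) {..<num_pts C k} (lattice_pts C k)"
  shows "(\<Prod>\<alpha>\<in>lattice_pts C k. min_weighted C K w k \<alpha>) \<le> vandermonde e C K w k"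
    and "vandermonde e C K w k \<le> fact (num_pts C k) * (\<Prod>\<alpha>\<in>lattice_pts C k. min_weighted C K w k \<alpha>)"
proof -
  let ?M = "num_pts C k"
  obtain s where s: "bij_betw s {..<?M} (lattice_pts C k)"
    and mono: "\<And>i j. i < j \<Longrightarrow> j < ?M \<Longrightarrow> prec (s i) (s j)"
    using finite_prec_enumeration[OF finite_lattice_pts[OF k]] unfolding num_pts_def by blast
  define f where "f = (\<lambda>i z. of_real (w z) ^ k * monomial (s i) z)"
  \<comment> \<open>The rearrangement taking the increasing enumeration \<open>s\<close> to the
    given \<open>e k\<close>; it is the identity from \<open>?M\<close> on, as
    \<open>permutes\<close> demands.\<close>
  define p where "p = (\<lambda>i. if i < ?M then inv_into {..<?M} s (e k i) else i)"
  have p: "p permutes {0..<?M}"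
  proof (rule bij_imp_permutes)
    have "bij_betw (inv_into {..<?M} s \<circ> e k) {..<?M} {..<?M}"
      by (rule bij_betw_trans[OF e bij_betw_inv_into[OF s]])
    then show "bij_betw p {0..<?M} {0..<?M}"
      unfolding atLeast0LessThan by (rule bij_betw_cong[THEN iffD1, rotated]) (auto simp: p_def)
  qed (simp add: p_def)
  have sp: "s (p i) = e k i" if "i < ?M" for i
  proof -
    have "e k i \<in> s ` {..<?M}" using that e s by (auto simp: bij_betw_def)
    then show ?thesis using that by (simp add: p_def f_inv_into_f)
  qed
  have "vandermonde e C K w k = max_det (\<lambda>i z. of_real (w z) ^ k * monomial (e k i) z) K ?M"
    unfolding vandermonde_def max_det_def fun_det_def ..
  also have "\<dots> = max_det (\<lambda>i. f (p i)) K ?M"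
  proof -
    have "fun_det (\<lambda>i z. of_real (w z) ^ k * monomial (e k i) z) ?M \<zeta> = fun_det (\<lambda>i. f (p i)) ?M \<zeta>" for \<zeta>
      by (rule fun_det_cong) (simp add: f_def sp)
    then show ?thesis unfolding max_det_def by simp
  qed
  also have "\<dots> = max_det f K ?M" by (rule max_det_permute[OF p])
  finally have V: "vandermonde e C K w k = max_det f K ?M" .
  have bounded: "bounded (f i ` K)" for i
    unfolding f_def by (rule bounded_weighted) (intro continuous_intros)
  have "(\<Prod>\<alpha>\<in>lattice_pts C k. min_weighted C K w k \<alpha>) = (\<Prod>i<?M. min_weighted C K w k (s i))"
    by (rule prod.reindex_bij_betw[OF s, symmetric])
  also have "\<dots> = (\<Prod>i<?M. min_norm f K i)"
    unfolding f_def using min_norm_enumeration[OF k s mono] by (intro prod.cong) auto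
  finally have P: "(\<Prod>\<alpha>\<in>lattice_pts C k. min_weighted C K w k \<alpha>) = (\<Prod>i<?M. min_norm f K i)" .
  show "(\<Prod>\<alpha>\<in>lattice_pts C k. min_weighted C K w k \<alpha>) \<le> vandermonde e C K w k"
    unfolding P V by (rule prod_min_norm_le_max_det[OF bounded])
  show "vandermonde e C K w k \<le> fact ?M * (\<Prod>\<alpha>\<in>lattice_pts C k. min_weighted C K w k \<alpha>)"
    unfolding P V by (rule max_det_le_prod_min_norm[OF bounded])
qed

end

section \<open>Limits of submultiplicative functions in interior directions\<close>

lemma direction_filter_le:
  "direction_filter C \<theta> \<le>
    filtercomap (\<lambda>(k, \<alpha>). (k, (1 / real k) *\<^sub>R real_vec \<alpha>)) (sequentially \<times>\<^sub>F nhds \<theta>)"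
  unfolding direction_filter_def by (rule inf_le1)

lemma filterlim_direction_filter:
  "filterlim (\<lambda>(k, \<alpha>). (k, (1 / real k) *\<^sub>R real_vec \<alpha>)) (sequentially \<times>\<^sub>F nhds \<theta>) (direction_filter C \<theta>)"
  unfolding filterlim_iff_le_filtercomap by (rule direction_filter_le)

lemma filterlim_fst_direction_filter: "filterlim fst sequentially (direction_filter C \<theta>)"
  using filterlim_compose[OF filterlim_fst filterlim_direction_filter[of \<theta> C]]
  by (simp add: case_prod_unfold)

lemma tendsto_direction_filter:
  "((\<lambda>x. (1 / real (fst x)) *\<^sub>R real_vec (snd x)) \<longlongrightarrow> \<theta>) (direction_filter C \<theta>)"
  using filterlim_compose[OF filterlim_snd filterlim_direction_filter[of \<theta> C]]
  by (simp add: case_prod_unfold)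

lemma eventually_lattice_pts:
  "\<forall>\<^sub>F x in direction_filter C \<theta>. snd x \<in> lattice_pts C (fst x)"
proof -
  have "direction_filter C \<theta> \<le> principal (SIGMA k:UNIV. lattice_pts C k)"
    unfolding direction_filter_def by (rule inf_le2)
  then show ?thesis by (rule filter_leD) (auto simp: eventually_principal)
qed

lemma filterlim_into_direction_filter:
  assumes "(\<lambda>k. (1 / real k) *\<^sub>R real_vec (X k)) \<longlonglongrightarrow> \<theta>"
    and "\<forall>\<^sub>F k in sequentially. X k \<in> lattice_pts C k"
  shows "filterlim (\<lambda>k. (k, X k)) (direction_filter C \<theta>) sequentially"
  unfolding direction_filter_def filterlim_inf filterlim_filtercomap_iff filterlim_principal
  using assms by (auto simp: o_def intro!: filterlim_Pair filterlim_ident)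

text \<open>The lower corner, scaled by k, of the grid cube of side \<open>1/k\<close> containing
  \<open>\<theta>\<close> when \<open>\<theta>\<close> has nonnegative coordinates. It serves twice:
  as a concrete sequence of lattice points in direction \<open>\<theta>\<close>, and as the sampling
  point of the Riemann sums.\<close>

definition floor_vec :: "nat \<Rightarrow> real ^ 'n \<Rightarrow> nat ^ 'n::finite" where
  "floor_vec k \<theta> = (\<chi> i. nat \<lfloor>real k * \<theta> $ i\<rfloor>)"

lemma tendsto_floor_over_n:
  fixes x :: real
  shows "(\<lambda>k. real_of_int \<lfloor>real k * x\<rfloor> / real k) \<longlonglongrightarrow> x"
proof (rule tendsto_sandwich)
  show "(\<lambda>k. x - 1 / real k) \<longlonglongrightarrow> x"
    using tendsto_diff[OF tendsto_const[of x] lim_const_over_n[of 1]] by simp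
  show "\<forall>\<^sub>F k in sequentially. x - 1 / real k \<le> real_of_int \<lfloor>real k * x\<rfloor> / real k"
    using eventually_gt_at_top[of 0]
  proof eventually_elim
    case (elim k)
    have "x - 1 / real k = (real k * x - 1) / real k"
      using elim by (simp add: diff_divide_distrib)
    also have "\<dots> \<le> real_of_int \<lfloor>real k * x\<rfloor> / real k"
      by (intro divide_right_mono) linarith+
    finally show ?case .
  qed
  show "\<forall>\<^sub>F k in sequentially. real_of_int \<lfloor>real k * x\<rfloor> / real k \<le> x"
    using eventually_gt_at_top[of 0]
  proof eventually_elim
    case (elim k)
    have "real_of_int \<lfloor>real k * x\<rfloor> / real k \<le> (real k * x) / real k"
      by (intro divide_right_mono) linarith+
    then show ?case using elim by simp
  qed
qed simp

lemma tendsto_floor_vec: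
  assumes "\<forall>i. 0 \<le> \<theta> $ i"
  shows "(\<lambda>k. (1 / real k) *\<^sub>R real_vec (floor_vec k \<theta>)) \<longlonglongrightarrow> \<theta>"
proof (rule vec_tendstoI)
  fix i
  have "((1 / real k) *\<^sub>R real_vec (floor_vec k \<theta>)) $ i = real_of_int \<lfloor>real k * \<theta> $ i\<rfloor> / real k" for k
    using assms by (simp add: real_vec_def floor_vec_def)
  then show "(\<lambda>k. ((1 / real k) *\<^sub>R real_vec (floor_vec k \<theta>)) $ i) \<longlonglongrightarrow> \<theta> $ i"
    using tendsto_floor_over_n by (simp only:)
qed

text \<open>The numerator is the largest multiple of \<open>k0\<close> not exceeding
  \<open>s * k\<close>: the part of \<open>k\<close> to be filled with copies of one fixed lattice
  point.\<close>

lemma tendsto_floor_multiple: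
  assumes "0 < k0" "0 \<le> s"
  shows "(\<lambda>k. real (nat \<lfloor>real k * (s / real k0)\<rfloor> * k0) / real k) \<longlonglongrightarrow> s"
  using tendsto_mult_right[OF tendsto_floor_over_n[of "s / real k0"], of "real k0"] assms by simp

context lattice_body
begin

lemma interior_nonneg: "\<theta> \<in> interior C \<Longrightarrow> \<forall>i. 0 \<le> \<theta> $ i"
  using interior_subset[of C] nonneg_C by auto

text \<open>Openness of the interior is essential: rounding down a boundary direction may leave
  \<open>C\<close>.\<close>

lemma eventually_floor_vec:
  assumes "\<theta> \<in> interior C"
  shows "\<forall>\<^sub>F k in sequentially. floor_vec k \<theta> \<in> lattice_pts C k"
  using topological_tendstoD[OF tendsto_floor_vec[OF interior_nonneg[OF assms]] open_interior assms]
    eventually_ge_at_top[of 1]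
proof eventually_elim
  case (elim k)
  then show ?case using interior_subset by (auto simp: lattice_pts_iff)
qed

lemma filterlim_floor_vec:
  "\<theta> \<in> interior C \<Longrightarrow> filterlim (\<lambda>k. (k, floor_vec k \<theta>)) (direction_filter C \<theta>) sequentially"
  by (intro filterlim_into_direction_filter tendsto_floor_vec interior_nonneg eventually_floor_vec)

text \<open>Nontriviality makes \<open>Lim\<close> along this filter unique and lets eventual bounds
  pass to the limit.\<close>

lemma direction_filter_neq_bot: "\<theta> \<in> interior C \<Longrightarrow> direction_filter C \<theta> \<noteq> bot"
  using filterlim_floor_vec[of \<theta>] unfolding filterlim_def
  by (metis bot.extremum_uniqueI filtermap_bot_iff sequentially_bot)

end

text \<open>The limit argument uses only these properties of the minimal weighted norms; polynomials
  do not occur in it.\<close>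

locale submultiplicative_body = lattice_body C
  for C :: "(real ^ 'n::{finite,linorder}) set" +
  fixes \<tau> :: "nat \<Rightarrow> nat ^ 'n::{finite,linorder} \<Rightarrow> real" and B :: real
  assumes B_ge_1: "1 \<le> B"
    and \<tau>_nonneg: "0 \<le> \<tau> k \<alpha>"
    and \<tau>_le: "1 \<le> k \<Longrightarrow> \<alpha> \<in> lattice_pts C k \<Longrightarrow> \<tau> k \<alpha> \<le> B ^ k"
    and \<tau>_add: "1 \<le> k \<Longrightarrow> 1 \<le> l \<Longrightarrow> \<alpha> \<in> lattice_pts C k \<Longrightarrow> \<beta> \<in> lattice_pts C l \<Longrightarrow>
      \<tau> (k + l) (\<alpha> + \<beta>) \<le> \<tau> k \<alpha> * \<tau> l \<beta>"
begin

definition root_\<tau> :: "nat \<Rightarrow> nat ^ 'n::{finite,linorder} \<Rightarrow> real" where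
  "root_\<tau> k \<alpha> = \<tau> k \<alpha> powr (1 / real k)"

lemma root_\<tau>_nonneg: "0 \<le> root_\<tau> k \<alpha>"
  by (simp add: root_\<tau>_def)

lemma root_\<tau>_power: "1 \<le> k \<Longrightarrow> root_\<tau> k \<alpha> ^ k = \<tau> k \<alpha>"
  using \<tau>_nonneg[of k \<alpha>] by (cases "\<tau> k \<alpha> = 0") (auto simp: root_\<tau>_def powr_realpow[symmetric] powr_powr)

lemma root_\<tau>_le: "1 \<le> k \<Longrightarrow> \<alpha> \<in> lattice_pts C k \<Longrightarrow> root_\<tau> k \<alpha> \<le> B"
  using \<tau>_le[of k \<alpha>] B_ge_1 root_\<tau>_power[of k \<alpha>] root_\<tau>_nonneg[of k \<alpha>]
    power_mono_iff[of "root_\<tau> k \<alpha>" B k] by simp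

lemma \<tau>_scale:
  assumes "1 \<le> k" "\<alpha> \<in> lattice_pts C k" "1 \<le> q"
  shows "\<tau> (q * k) (q *s \<alpha>) \<le> \<tau> k \<alpha> ^ q"
  using assms(3)
proof (induction q rule: dec_induct)
  case base
  have "1 *s \<alpha> = \<alpha>" by (simp add: vec_eq_iff)
  then show ?case by (simp only: mult_1 power_one_right order_refl)
next
  case (step q)
  have "Suc q *s \<alpha> = \<alpha> + q *s \<alpha>" by (simp add: vec_eq_iff)
  then have "\<tau> (Suc q * k) (Suc q *s \<alpha>) \<le> \<tau> k \<alpha> * \<tau> (q * k) (q *s \<alpha>)"
    using \<tau>_add[of k "q * k" \<alpha> "q *s \<alpha>"] lattice_pts_scale[of k q \<alpha>] assms step by simp
  also have "\<dots> \<le> \<tau> k \<alpha> * \<tau> k \<alpha> ^ q"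
    using step \<tau>_nonneg by (intro mult_left_mono) auto
  finally show ?case by simp
qed

text \<open>With \<open>r = k - q * k0\<close> and
  \<open>\<beta> = \<alpha> - q *s \<alpha>0\<close>, the last hypothesis says that
  \<open>\<beta>\<close> is a lattice point of the dilate \<open>r\<close>. Submultiplicativity
  bounds the multiple of \<open>\<alpha>0\<close> by a power, the remainder by \<open>B ^ r\<close>,
  and the k-th root turns both into a weighted geometric mean.\<close>

lemma root_\<tau>_decompose:
  assumes k0: "1 \<le> k0" "\<alpha>0 \<in> lattice_pts C k0" and q: "1 \<le> q" "q * k0 < k"
    and \<rho>: "(1 / (real k - real (q * k0))) *\<^sub>R (real_vec \<alpha> - real q *\<^sub>R real_vec \<alpha>0) \<in> C"
  shows "root_\<tau> k \<alpha> \<le> root_\<tau> k0 \<alpha>0 powr (real (q * k0) / real k) * B powr (1 - real (q * k0) / real k)"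
proof -
  define r where "r = k - q * k0"
  define \<beta> where "\<beta> = \<alpha> - q *s \<alpha>0"
  have r: "1 \<le> r" "real r = real k - real (q * k0)" "k = q * k0 + r"
    using q by (auto simp: r_def of_nat_diff)
  \<comment> \<open>Since \<open>C\<close> lies in the nonnegative orthant, the subtraction of
    natural numbers defining \<open>\<beta>\<close> never truncates.\<close>
  have le: "q * \<alpha>0 $ i \<le> \<alpha> $ i" for i
  proof -
    have "0 \<le> (1 / real r) * (real (\<alpha> $ i) - real q * real (\<alpha>0 $ i))"
      using \<rho> nonneg_C unfolding r(2)[symmetric] by (auto simp: real_vec_def)
    then have "real (q * \<alpha>0 $ i) \<le> real (\<alpha> $ i)" using r(1) by (simp add: zero_le_divide_iff)
    then show ?thesis by linarith
  qed
  have \<alpha>: "\<alpha> = q *s \<alpha>0 + \<beta>"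
    using le by (simp add: \<beta>_def vec_eq_iff)
  have "real_vec \<alpha> - real q *\<^sub>R real_vec \<alpha>0 = real_vec \<beta>"
    by (simp add: \<alpha> real_vec_add real_vec_scale)
  then have "(1 / real r) *\<^sub>R real_vec \<beta> \<in> C"
    using \<rho> by (simp only: r(2))
  then have \<beta>: "\<beta> \<in> lattice_pts C r"
    using r(1) by (simp add: lattice_pts_iff)
  have "\<tau> k \<alpha> \<le> \<tau> (q * k0) (q *s \<alpha>0) * \<tau> r \<beta>"
    unfolding \<alpha> r(3) using q r(1) k0 \<beta> by (intro \<tau>_add lattice_pts_scale) auto
  also have "\<dots> \<le> \<tau> k0 \<alpha>0 ^ q * B ^ r"
    using k0 q r(1) \<beta> \<tau>_nonneg by (intro mult_mono \<tau>_scale \<tau>_le) auto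
  also have "\<tau> k0 \<alpha>0 ^ q = root_\<tau> k0 \<alpha>0 ^ (q * k0)"
    by (simp only: root_\<tau>_power[OF k0(1), symmetric] power_mult[symmetric] mult.commute)
  finally have "root_\<tau> k \<alpha> \<le> (root_\<tau> k0 \<alpha>0 ^ (q * k0) * B ^ r) powr (1 / real k)"
    unfolding root_\<tau>_def[of k] using \<tau>_nonneg by (intro powr_mono2) auto
  also have "\<dots> = root_\<tau> k0 \<alpha>0 powr (real (q * k0) / real k) * B powr (real r / real k)"
  proof (cases "root_\<tau> k0 \<alpha>0 = 0")
    case True
    then show ?thesis using q k0 by simp
  next
    case False
    then have "0 < root_\<tau> k0 \<alpha>0" using root_\<tau>_nonneg[of k0 \<alpha>0] by simp
    then show ?thesis using B_ge_1
      by (simp add: powr_mult powr_realpow[symmetric] powr_powr del: of_nat_mult)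
  qed
  also have "real r / real k = 1 - real (q * k0) / real k"
    using q by (simp add: r(2) diff_divide_distrib)
  finally show ?thesis .
qed

text \<open>
  Write \<open>(k, \<alpha>)\<close> as a multiple of \<open>(k0, \<alpha>0)\<close> that makes up the proportion \<open>s\<close> of it, plus a remainder,
  which is a lattice point of its multiple of \<open>C\<close> and is bounded trivially.
\<close>

lemma eventually_root_\<tau>_less:
  assumes k0: "1 \<le> k0" "\<alpha>0 \<in> lattice_pts C k0" and s: "0 < s" "s < 1"
    and \<psi>: "(1 / (1 - s)) *\<^sub>R (\<theta> - s *\<^sub>R ((1 / real k0) *\<^sub>R real_vec \<alpha>0)) \<in> interior C"
    and u: "root_\<tau> k0 \<alpha>0 powr s * B powr (1 - s) < u"
  shows "\<forall>\<^sub>F x in direction_filter C \<theta>. root_\<tau> (fst x) (snd x) < u"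
proof -
  define q where "q = (\<lambda>k. nat \<lfloor>real k * (s / real k0)\<rfloor>)"
  define t where "t = (\<lambda>k. real (q k * k0) / real k)"
  define F where "F = direction_filter C \<theta>"
  have t: "((\<lambda>x. t (fst x)) \<longlongrightarrow> s) F"
    unfolding t_def q_def F_def using k0 s
    by (intro filterlim_compose[OF tendsto_floor_multiple filterlim_fst_direction_filter]) auto
  have dir: "((\<lambda>x. (1 / real (fst x)) *\<^sub>R real_vec (snd x)) \<longlongrightarrow> \<theta>) F"
    unfolding F_def by (rule tendsto_direction_filter)
  \<comment> \<open>The rescaled remainder converges to the point that \<open>\<psi>\<close> places
    in the interior, so it eventually lies in \<open>C\<close>, whichever pairs
    \<open>(k, \<alpha>)\<close> approach \<open>\<theta>\<close>.\<close>
  have "((\<lambda>x. (1 / (1 - t (fst x))) *\<^sub>R ((1 / real (fst x)) *\<^sub>R real_vec (snd x)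
      - t (fst x) *\<^sub>R ((1 / real k0) *\<^sub>R real_vec \<alpha>0)))
      \<longlongrightarrow> (1 / (1 - s)) *\<^sub>R (\<theta> - s *\<^sub>R ((1 / real k0) *\<^sub>R real_vec \<alpha>0))) F"
    using s by (intro tendsto_intros t dir) auto
  from topological_tendstoD[OF this open_interior \<psi>]
  have ev1: "\<forall>\<^sub>F x in F. (1 / (1 - t (fst x))) *\<^sub>R ((1 / real (fst x)) *\<^sub>R real_vec (snd x)
      - t (fst x) *\<^sub>R ((1 / real k0) *\<^sub>R real_vec \<alpha>0)) \<in> interior C" .
  have "((\<lambda>x. root_\<tau> k0 \<alpha>0 powr t (fst x) * B powr (1 - t (fst x)))
      \<longlongrightarrow> root_\<tau> k0 \<alpha>0 powr s * B powr (1 - s)) F"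
    using s B_ge_1 root_\<tau>_nonneg by (intro tendsto_intros t) auto
  from order_tendstoD(2)[OF this u]
  have ev2: "\<forall>\<^sub>F x in F. root_\<tau> k0 \<alpha>0 powr t (fst x) * B powr (1 - t (fst x)) < u" .
  have "\<forall>\<^sub>F x in F. 1 \<le> fst x"
    using filterlim_fst_direction_filter[of C \<theta>] unfolding F_def
    by (rule filterlim_at_top[THEN iffD1, rule_format])
  then show ?thesis
    unfolding F_def[symmetric] using ev1 ev2 order_tendstoD(1)[OF t s(1)] order_tendstoD(2)[OF t s(2)]
  proof eventually_elim
    case (elim x)
    define k \<alpha> where "k = fst x" and "\<alpha> = snd x"
    have k: "1 \<le> k" "0 < t k" "t k < 1" using elim by (auto simp: k_def)
    have q: "1 \<le> q k" using k(2) by (cases "q k") (auto simp: t_def)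
    have lt: "q k * k0 < k" using k unfolding t_def by (simp del: of_nat_mult)
    have tk: "t k * real k = real (q k) * real k0" using k by (simp add: t_def)
    have tq: "t k / real k0 = real (q k) / real k" using tk k k0 by (simp add: field_simps)
    have d: "real k - real (q k * k0) = real k * (1 - t k)"
      using tk by (simp add: algebra_simps)
    have "(1 / (1 - t k)) *\<^sub>R ((1 / real k) *\<^sub>R real_vec \<alpha> - t k *\<^sub>R ((1 / real k0) *\<^sub>R real_vec \<alpha>0)) =
        (1 / (real k - real (q k * k0))) *\<^sub>R (real_vec \<alpha> - real (q k) *\<^sub>R real_vec \<alpha>0)"
      unfolding d using tq by (simp add: scaleR_diff_right mult.commute)
    then have "(1 / (real k - real (q k * k0))) *\<^sub>R (real_vec \<alpha> - real (q k) *\<^sub>R real_vec \<alpha>0) \<in> C"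
      using elim(2) interior_subset[of C] by (auto simp: k_def \<alpha>_def)
    from root_\<tau>_decompose[OF k0 q lt this]
    have "root_\<tau> k \<alpha> \<le> root_\<tau> k0 \<alpha>0 powr t k * B powr (1 - t k)"
      unfolding t_def .
    then show ?case using elim(3) by (simp add: k_def \<alpha>_def)
  qed
qed

lemma eventually_good_direction:
  "\<forall>\<^sub>F x in direction_filter C \<theta>. 1 \<le> fst x \<and> snd x \<in> lattice_pts C (fst x)"
  using filterlim_at_top[THEN iffD1, rule_format, OF filterlim_fst_direction_filter[of C \<theta>], of 1]
    eventually_lattice_pts[of C \<theta>] by eventually_elim simp

text \<open>A Fekete argument: a value that the roots undercut frequently is, up to an arbitrarily
  small loss, undercut eventually, because one good pair near \<open>\<theta>\<close> controls all
  later ones. Lower and upper limit therefore agree.\<close>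

lemma convergent_root_\<tau>:
  assumes \<theta>: "\<theta> \<in> interior C"
  obtains L where "0 \<le> L" "((\<lambda>x. root_\<tau> (fst x) (snd x)) \<longlongrightarrow> L) (direction_filter C \<theta>)"
proof -
  define F where "F = direction_filter C \<theta>"
  have nb: "F \<noteq> bot" unfolding F_def by (rule direction_filter_neq_bot[OF \<theta>])
  note good = eventually_good_direction[of \<theta>, folded F_def]
  \<comment> \<open>The infimum of this set is the lower limit along the filter.\<close>
  define A where "A = {u. \<exists>\<^sub>F x in F. root_\<tau> (fst x) (snd x) < u}"
  define L where "L = Inf A"
  have pos: "0 < u" if "u \<in> A" for u
    using that root_\<tau>_nonneg unfolding A_def
    by (auto dest!: frequently_ex intro: order_le_less_trans)
  have "\<forall>\<^sub>F x in F. root_\<tau> (fst x) (snd x) < B + 1"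
    using good by eventually_elim (use root_\<tau>_le in fastforce)
  then have "B + 1 \<in> A"
    unfolding A_def using eventually_frequently[OF nb] by blast
  then have ne: "A \<noteq> {}" by auto
  have bdd: "bdd_below A" using pos by (auto intro!: bdd_belowI[of _ 0] less_imp_le)
  have "((\<lambda>x. root_\<tau> (fst x) (snd x)) \<longlongrightarrow> L) F"
  proof (rule order_tendstoI)
    fix a assume "a < L"
    then obtain a' where a': "a < a'" "a' < L" using dense by blast
    then have "a' \<notin> A" unfolding L_def using cInf_lower[OF _ bdd] by fastforce
    then have "\<forall>\<^sub>F x in F. a' \<le> root_\<tau> (fst x) (snd x)"
      unfolding A_def frequently_def by (simp add: not_less)
    then show "\<forall>\<^sub>F x in F. a < root_\<tau> (fst x) (snd x)"
      by eventually_elim (use a' in auto)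
  next
    fix a assume "L < a"
    then obtain u where u: "u \<in> A" "u < a" unfolding L_def using cInf_less_iff[OF ne bdd] by auto
    \<comment> \<open>The proportion \<open>s\<close> is fixed before the pair: near 1 it makes the
      cost of the remainder negligible. Once it is fixed, a pair close enough to
      \<open>\<theta>\<close> leaves a complementary direction close to \<open>\<theta>\<close>,
      hence interior.\<close>
    have "((\<lambda>s. u powr s * B powr (1 - s)) \<longlongrightarrow> u powr 1 * B powr (1 - 1)) (at_left 1)"
      using pos[OF u(1)] B_ge_1 by (intro tendsto_intros) auto
    then have "((\<lambda>s. u powr s * B powr (1 - s)) \<longlongrightarrow> u) (at_left 1)"
      using pos[OF u(1)] B_ge_1 by simp
    from order_tendstoD(2)[OF this u(2)] eventually_at_left_real[of 0 "1::real"]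
    have "\<forall>\<^sub>F s in at_left 1. u powr s * B powr (1 - s) < a \<and> s \<in> {0<..<1}"
      by (simp add: eventually_conj_iff)
    then obtain s where s: "u powr s * B powr (1 - s) < a" "0 < s" "s < 1"
      by (auto dest!: eventually_happens)
    have "((\<lambda>x. (1 / (1 - s)) *\<^sub>R (\<theta> - s *\<^sub>R ((1 / real (fst x)) *\<^sub>R real_vec (snd x))))
      \<longlongrightarrow> (1 / (1 - s)) *\<^sub>R (\<theta> - s *\<^sub>R \<theta>)) F"
      unfolding F_def by (intro tendsto_intros tendsto_direction_filter)
    moreover have "(1 / (1 - s)) *\<^sub>R (\<theta> - s *\<^sub>R \<theta>) = \<theta>"
    proof -
      have "\<theta> - s *\<^sub>R \<theta> = (1 - s) *\<^sub>R \<theta>" by (simp add: scaleR_diff_left)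
      then show ?thesis using s by simp
    qed
    ultimately have "\<forall>\<^sub>F x in F.
        (1 / (1 - s)) *\<^sub>R (\<theta> - s *\<^sub>R ((1 / real (fst x)) *\<^sub>R real_vec (snd x))) \<in> interior C"
      using topological_tendstoD[OF _ open_interior] \<theta> by fastforce
    with good have "\<forall>\<^sub>F x in F. (1 \<le> fst x \<and> snd x \<in> lattice_pts C (fst x)) \<and>
        (1 / (1 - s)) *\<^sub>R (\<theta> - s *\<^sub>R ((1 / real (fst x)) *\<^sub>R real_vec (snd x))) \<in> interior C"
      by (rule eventually_conj)
    moreover have "\<exists>\<^sub>F x in F. root_\<tau> (fst x) (snd x) < u" using u by (simp add: A_def)
    ultimately obtain x where x: "1 \<le> fst x" "snd x \<in> lattice_pts C (fst x)"
      and in_int: "(1 / (1 - s)) *\<^sub>R (\<theta> - s *\<^sub>R ((1 / real (fst x)) *\<^sub>R real_vec (snd x))) \<in> interior C"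
      and less: "root_\<tau> (fst x) (snd x) < u"
      using frequently_ex[OF frequently_eventually_conj] by blast
    have "root_\<tau> (fst x) (snd x) powr s * B powr (1 - s) \<le> u powr s * B powr (1 - s)"
      using less s root_\<tau>_nonneg by (intro mult_right_mono powr_mono2) auto
    then show "\<forall>\<^sub>F x in F. root_\<tau> (fst x) (snd x) < a"
      unfolding F_def using s by (intro eventually_root_\<tau>_less[OF x _ _ in_int]) auto
  qed
  moreover have "0 \<le> L"
    unfolding L_def using ne pos by (intro cInf_greatest) (auto intro: less_imp_le)
  ultimately show ?thesis using that unfolding F_def by blast
qed

text \<open>
  A single interior direction with positive limit is a convex combination, with a fixed weight \<open>s\<close>,
  of any given lattice direction and some other interior direction.
\<close>

lemma root_\<tau>_bounded_below:
  assumes \<theta>: "\<theta> \<in> interior C" and L: "0 < L"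
    and lim: "((\<lambda>x. root_\<tau> (fst x) (snd x)) \<longlongrightarrow> L) (direction_filter C \<theta>)"
  obtains b where "0 < b" "\<And>k \<alpha>. 1 \<le> k \<Longrightarrow> \<alpha> \<in> lattice_pts C k \<Longrightarrow> b \<le> root_\<tau> k \<alpha>"
proof -
  obtain r where r: "0 < r" "ball \<theta> r \<subseteq> interior C"
    using \<theta> open_interior[of C] by (metis open_contains_ball)
  obtain d0 where d0: "\<And>\<phi>. \<phi> \<in> C \<Longrightarrow> dist \<theta> \<phi> \<le> d0"
    using compact_imp_bounded[OF compact_C] by (auto simp: bounded_any_center[of _ \<theta>])
  define d where "d = max d0 1"
  \<comment> \<open>The complementary direction differs from \<open>\<theta>\<close> by
    \<open>(s / (1 - s)) *\<^sub>R (\<theta> - \<phi>)\<close>. This \<open>s\<close> makes the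
    length at most \<open>r / 2\<close>, uniformly over all \<open>\<phi>\<close> in
    \<open>C\<close>, which includes the boundary.\<close>
  define s where "s = r / (r + 2 * d)"
  have d: "0 < d" "\<And>\<phi>. \<phi> \<in> C \<Longrightarrow> norm (\<theta> - \<phi>) \<le> d"
    using d0 by (force simp: d_def dist_norm)+
  have s': "1 - s = 2 * d / (r + 2 * d)"
    using r d(1) by (simp add: s_def field_simps)
  have s: "0 < s" "s < 1"
    using r d(1) by (auto simp: s_def)
  have sd: "s / (1 - s) * d = r / 2"
    unfolding s' using r d(1) by (simp add: s_def)
  have in_int: "(1 / (1 - s)) *\<^sub>R (\<theta> - s *\<^sub>R \<phi>) \<in> interior C" if "\<phi> \<in> C" for \<phi>
  proof -
    have "(x - s * y) / (1 - s) - x = s * (x - y) / (1 - s)" for x y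
    proof -
      have "(x - s * y) / (1 - s) - x = (x - s * y) / (1 - s) - (1 - s) * x / (1 - s)"
        using s by simp
      also have "\<dots> = (x - s * y - (1 - s) * x) / (1 - s)"
        by (simp only: diff_divide_distrib)
      also have "x - s * y - (1 - s) * x = s * (x - y)" by (simp add: algebra_simps)
      finally show ?thesis .
    qed
    then have "(1 / (1 - s)) *\<^sub>R (\<theta> - s *\<^sub>R \<phi>) - \<theta> = (s / (1 - s)) *\<^sub>R (\<theta> - \<phi>)"
      by (simp add: vec_eq_iff)
    then have "norm ((1 / (1 - s)) *\<^sub>R (\<theta> - s *\<^sub>R \<phi>) - \<theta>) = s / (1 - s) * norm (\<theta> - \<phi>)"
      using s by simp
    also have "\<dots> \<le> s / (1 - s) * d"
      using s d(2)[OF that] by (intro mult_left_mono) auto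
    also have "\<dots> < r" unfolding sd using r by simp
    finally show ?thesis using r by (auto simp: dist_norm norm_minus_commute subset_iff)
  qed
  \<comment> \<open>The solution of \<open>b powr s * B powr (1 - s) = L\<close>: any smaller root
    would force the limit in direction \<open>\<theta>\<close> below \<open>L\<close>.\<close>
  define b where "b = (L / B powr (1 - s)) powr (1 / s)"
  have "0 < b" using L B_ge_1 by (simp add: b_def)
  moreover have "b \<le> root_\<tau> k \<alpha>" if k: "1 \<le> k" "\<alpha> \<in> lattice_pts C k" for k \<alpha>
  proof (rule ccontr)
    assume "\<not> b \<le> root_\<tau> k \<alpha>"
    then have "root_\<tau> k \<alpha> powr s < b powr s"
      using s root_\<tau>_nonneg by (intro powr_less_mono2) auto
    also have "b powr s = L / B powr (1 - s)"
      using s L B_ge_1 by (simp add: b_def powr_powr)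
    finally have "root_\<tau> k \<alpha> powr s * B powr (1 - s) < L"
      using B_ge_1 by (simp add: pos_less_divide_eq)
    then obtain u where u: "root_\<tau> k \<alpha> powr s * B powr (1 - s) < u" "u < L" using dense by blast
    have "(1 / real k) *\<^sub>R real_vec \<alpha> \<in> C" using k lattice_pts_iff by blast
    from eventually_root_\<tau>_less[OF k s(1,2) in_int[OF this] u(1)]
    have "\<forall>\<^sub>F x in direction_filter C \<theta>. root_\<tau> (fst x) (snd x) \<le> u"
      by eventually_elim simp
    from tendsto_upperbound[OF lim this direction_filter_neq_bot[OF \<theta>]] u show False by simp
  qed
  ultimately show ?thesis using that by blast
qed

end

section \<open>Riemann sums over lattice points\<close>

text \<open>Half-open, so that for \<open>k \<ge> 1\<close> the cubes partition the nonnegative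
  orthant and the cube of a point is determined by \<open>floor_vec\<close>.\<close>

definition cube :: "nat \<Rightarrow> nat ^ 'n::finite \<Rightarrow> (real ^ 'n::finite) set" where
  "cube k \<alpha> = {\<theta>. \<forall>i. real (\<alpha> $ i) \<le> real k * \<theta> $ i \<and> real k * \<theta> $ i < real (\<alpha> $ i) + 1}"

lemma in_cube_iff:
  "\<theta> \<in> cube k \<alpha> \<longleftrightarrow> (\<forall>i. 0 \<le> real k * \<theta> $ i) \<and> \<alpha> = floor_vec k \<theta>"
proof -
  have "real a \<le> x \<and> x < real a + 1 \<longleftrightarrow> 0 \<le> x \<and> a = nat \<lfloor>x\<rfloor>" for a x
    by linarith
  then show ?thesis unfolding cube_def floor_vec_def vec_eq_iff by auto
qed

lemma cube_measure:
  fixes \<alpha> :: "nat ^ 'n::finite"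
  assumes "1 \<le> k"
  shows "cube k \<alpha> \<in> lmeasurable" "measure lebesgue (cube k \<alpha>) = 1 / real k ^ CARD('n)"
proof -
  define a :: "real ^ 'n::finite" where "a = (\<chi> i. real (\<alpha> $ i) / real k)"
  define b :: "real ^ 'n::finite" where "b = (\<chi> i. (real (\<alpha> $ i) + 1) / real k)"
  have sub: "box a b \<subseteq> cube k \<alpha>" "cube k \<alpha> \<subseteq> cbox a b"
    using assms by (auto simp: cube_def mem_box_cart a_def b_def field_simps less_imp_le)
  have neg: "negligible (cbox a b - cube k \<alpha> \<union> (cube k \<alpha> - cbox a b))"
    by (rule negligible_subset[OF negligible_frontier_interval[of a b]]) (use sub in auto)
  show "cube k \<alpha> \<in> lmeasurable"
    by (rule lmeasurable_negligible_symdiff[OF lmeasurable_cbox neg])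
  have "measure lebesgue (cube k \<alpha>) = measure lebesgue (cbox a b)"
    by (rule measure_negligible_symdiff[OF _ neg]) simp
  also have "\<dots> = content (cbox a b)" by simp
  also have "\<dots> = (\<Prod>i\<in>UNIV. b $ i - a $ i)"
    using assms by (subst content_cbox_cart)
      (auto simp: interval_ne_empty_cart a_def b_def divide_right_mono)
  also have "\<dots> = 1 / real k ^ CARD('n)"
    by (simp add: a_def b_def diff_divide_distrib[symmetric] power_one_over)
  finally show "measure lebesgue (cube k \<alpha>) = 1 / real k ^ CARD('n)" .
qed

context lattice_body
begin

definition step_fun :: "(nat \<Rightarrow> nat ^ 'n::{finite,linorder} \<Rightarrow> real) \<Rightarrow> nat \<Rightarrow> real ^ 'n::{finite,linorder} \<Rightarrow> real" where
  "step_fun g k \<theta> = (\<Sum>\<alpha>\<in>lattice_pts C k. g k \<alpha> * indicator (cube k \<alpha>) \<theta>)"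

text \<open>At most one cube contains \<open>\<theta>\<close>. The sign condition is needed because
  \<open>nat\<close> rounds negative coordinates to 0, so \<open>floor_vec\<close> alone does not
  detect points outside the orthant.\<close>

lemma step_fun_eq:
  assumes "1 \<le> k"
  shows "step_fun g k \<theta> =
    (if (\<forall>i. 0 \<le> \<theta> $ i) \<and> floor_vec k \<theta> \<in> lattice_pts C k then g k (floor_vec k \<theta>) else 0)"
proof -
  have nn: "(\<forall>i. 0 \<le> real k * \<theta> $ i) \<longleftrightarrow> (\<forall>i. 0 \<le> \<theta> $ i)"
    using assms by (auto simp: zero_le_mult_iff)
  have "step_fun g k \<theta> =
      (\<Sum>\<alpha>\<in>lattice_pts C k. if \<alpha> = floor_vec k \<theta> then (if \<forall>i. 0 \<le> \<theta> $ i then g k \<alpha> else 0) else 0)"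
    unfolding step_fun_def by (rule sum.cong) (auto simp: indicator_def in_cube_iff nn)
  then show ?thesis using finite_lattice_pts[OF assms] by (simp add: sum.delta')
qed

lemma step_fun_integral:
  assumes "1 \<le> k"
  shows "integrable lebesgue (step_fun g k)"
    and "(LINT \<theta>|lebesgue. step_fun g k \<theta>) = (\<Sum>\<alpha>\<in>lattice_pts C k. g k \<alpha>) / real k ^ CARD('n)"
proof -
  have int: "integrable lebesgue (indicator (cube k \<alpha>) :: _ \<Rightarrow> real)" for \<alpha> :: "nat ^ 'n::{finite,linorder}"
    using cube_measure(1)[OF assms, of \<alpha>] by (intro integrable_real_indicator) (auto simp: fmeasurable_def)
  show "integrable lebesgue (step_fun g k)"
    unfolding step_fun_def[abs_def] using int by (intro Bochner_Integration.integrable_sum integrable_mult_right)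
  show "(LINT \<theta>|lebesgue. step_fun g k \<theta>) = (\<Sum>\<alpha>\<in>lattice_pts C k. g k \<alpha>) / real k ^ CARD('n)"
    unfolding step_fun_def using int
    by (simp add: Bochner_Integration.integral_sum cube_measure(2)[OF assms] sum_divide_distrib)
qed

text \<open>The normalised sums are integrals of step functions, which converge to \<open>h\<close>
  on the interior and to 0 off the closed set \<open>C\<close>; the frontier of a convex set is
  null. Boundary terms thus need only the common bound \<open>b\<close>, not a limit.\<close>

lemma riemann_sums:
  fixes g :: "nat \<Rightarrow> nat ^ 'n::{finite,linorder} \<Rightarrow> real"
  assumes bound: "\<And>k \<alpha>. 1 \<le> k \<Longrightarrow> \<alpha> \<in> lattice_pts C k \<Longrightarrow> \<bar>g k \<alpha>\<bar> \<le> b"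
    and lim: "\<And>\<theta>. \<theta> \<in> interior C \<Longrightarrow> (\<lambda>k. g k (floor_vec k \<theta>)) \<longlonglongrightarrow> h \<theta>"
  shows "integrable (lebesgue_on (interior C)) h"
    and "(\<lambda>k. (\<Sum>\<alpha>\<in>lattice_pts C k. g k \<alpha>) / real k ^ CARD('n))
      \<longlonglongrightarrow> (LINT \<theta>|lebesgue_on (interior C). h \<theta>)"
proof -
  \<comment> \<open>The shift to \<open>Suc k\<close> makes the bounds hold for every term of the
    sequence, as dominated convergence requires; they are assumed only from 1 on.\<close>
  define F where "F = (\<lambda>k. step_fun g (Suc k))"
  define H where "H = (\<lambda>\<theta>. indicator (interior C) \<theta> *\<^sub>R h \<theta>)"
  obtain R where R: "\<forall>k\<ge>1. \<forall>\<alpha>\<in>lattice_pts C k. mdeg \<alpha> \<le> k * R" using mdeg_bound by auto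
  \<comment> \<open>A box containing the supports of all the step functions: cubes may stick out of
    \<open>C\<close>, but by at most their side \<open>1 / Suc k \<le> 1\<close>.\<close>
  define X :: "(real ^ 'n::{finite,linorder}) set" where "X = cbox 0 (\<chi> i. real R + 1)"
  have b: "0 \<le> b" using bound[of 1 0] zero_in_lattice_pts by force
  have dom: "norm (F k \<theta>) \<le> b * indicator X \<theta>" for k \<theta>
  proof (cases "(\<forall>i. 0 \<le> \<theta> $ i) \<and> floor_vec (Suc k) \<theta> \<in> lattice_pts C (Suc k)")
    case True
    have "\<theta> $ i \<le> real R + 1" for i
    proof -
      have "floor_vec (Suc k) \<theta> $ i \<le> Suc k * R"
        using R True component_le_mdeg order_trans by (metis le_add1 plus_1_eq_Suc)
      then have "real (Suc k) * \<theta> $ i < real (Suc k * R) + 1"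
        unfolding floor_vec_def vec_lambda_beta by linarith
      also have "\<dots> \<le> real (Suc k) * (real R + 1)" by (simp add: algebra_simps)
      finally show ?thesis by simp
    qed
    then have "\<theta> \<in> X" using True
      by (auto simp: X_def mem_box_cart)
    then show ?thesis using True bound[of "Suc k" "floor_vec (Suc k) \<theta>"]
      by (simp add: F_def step_fun_eq)
  qed (use b in \<open>auto simp: F_def step_fun_eq\<close>)
  have lim_int: "(\<lambda>k. F k \<theta>) \<longlonglongrightarrow> h \<theta>" if \<theta>: "\<theta> \<in> interior C" for \<theta>
  proof -
    have "\<forall>\<^sub>F k in sequentially. g k (floor_vec k \<theta>) = step_fun g k \<theta>"
      using eventually_floor_vec[OF \<theta>] eventually_ge_at_top[of 1]
      by eventually_elim (use interior_nonneg[OF \<theta>] in \<open>simp add: step_fun_eq\<close>)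
    then have "(\<lambda>k. step_fun g k \<theta>) \<longlonglongrightarrow> h \<theta>" using lim[OF \<theta>] by (rule Lim_transform_eventually[rotated])
    then show ?thesis unfolding F_def by (rule LIMSEQ_Suc)
  qed
  have lim_ext: "(\<lambda>k. F k \<theta>) \<longlonglongrightarrow> 0" if \<theta>: "\<theta> \<notin> C" for \<theta>
  proof -
    have "\<forall>\<^sub>F k in sequentially. step_fun g k \<theta> = 0"
    proof (cases "\<forall>i. 0 \<le> \<theta> $ i")
      case True
      have "\<forall>\<^sub>F k in sequentially. (1 / real k) *\<^sub>R real_vec (floor_vec k \<theta>) \<in> - C"
        using tendsto_floor_vec[OF True] \<theta> compact_imp_closed[OF compact_C]
        by (intro topological_tendstoD) (auto simp: open_Compl)
      with eventually_ge_at_top[of 1] show ?thesis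
        by eventually_elim (auto simp: step_fun_eq lattice_pts_iff)
    next
      case False
      show ?thesis using eventually_ge_at_top[of 1]
        by eventually_elim (use False in \<open>auto simp: step_fun_eq\<close>)
    qed
    then have "(\<lambda>k. step_fun g k \<theta>) \<longlonglongrightarrow> 0" by (rule tendsto_eventually)
    then show ?thesis unfolding F_def by (rule LIMSEQ_Suc)
  qed
  have meas_F: "F k \<in> borel_measurable lebesgue" for k
    unfolding F_def by (rule borel_measurable_integrable[OF step_fun_integral(1)]) simp
  have int_sets: "interior C \<in> sets lebesgue" by simp
  \<comment> \<open>No regularity of \<open>h\<close> is assumed; its measurability on the interior
    comes from being a pointwise limit of step functions.\<close>
  have meas_H: "H \<in> borel_measurable lebesgue"
  proof (rule borel_measurable_LIMSEQ_real)
    show "(\<lambda>k. indicator (interior C) \<theta> * F k \<theta>) \<longlonglongrightarrow> H \<theta>" for \<theta>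
      using lim_int[of \<theta>] by (cases "\<theta> \<in> interior C") (auto simp: H_def)
    show "(\<lambda>\<theta>. indicator (interior C) \<theta> * F k \<theta>) \<in> borel_measurable lebesgue" for k
      using meas_F int_sets by measurable
  qed
  have AE_frontier: "AE \<theta> in lebesgue. \<theta> \<notin> frontier C"
    using negligible_convex_frontier[OF convex_C] by (intro AE_not_in) (simp add: negligible_iff_null_sets)
  have AE_lim: "AE \<theta> in lebesgue. (\<lambda>k. F k \<theta>) \<longlonglongrightarrow> H \<theta>"
    using AE_frontier
  proof (rule AE_mp, intro AE_I2 impI)
    fix \<theta> assume "\<theta> \<notin> frontier C"
    then consider "\<theta> \<in> interior C" | "\<theta> \<notin> C"
      using compact_imp_closed[OF compact_C] by (auto simp: frontier_def)
    then show "(\<lambda>k. F k \<theta>) \<longlonglongrightarrow> H \<theta>"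
    proof cases
      case 1
      then show ?thesis using lim_int by (simp add: H_def)
    next
      case 2
      then have "\<theta> \<notin> interior C" using interior_subset[of C] by auto
      then show ?thesis using lim_ext[OF 2] by (simp add: H_def)
    qed
  qed
  have int_dom: "integrable lebesgue (\<lambda>\<theta>. b * indicator X \<theta>)"
    unfolding X_def by (intro integrable_mult_right integrable_real_indicator)
      (use lmeasurable_cbox in \<open>auto simp: fmeasurable_def\<close>)
  have AE_dom: "AE \<theta> in lebesgue. norm (F k \<theta>) \<le> b * indicator X \<theta>" for k
    using dom by simp
  have "integrable lebesgue H"
    by (rule integrable_dominated_convergence[OF meas_H meas_F int_dom AE_lim AE_dom])
  then show "integrable (lebesgue_on (interior C)) h"
    using int_sets by (simp add: integrable_restrict_space H_def)
  have "(\<lambda>k. LINT \<theta>|lebesgue. F k \<theta>) \<longlonglongrightarrow> (LINT \<theta>|lebesgue. H \<theta>)"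
    by (rule integral_dominated_convergence[OF meas_H meas_F int_dom AE_lim AE_dom])
  also have "(LINT \<theta>|lebesgue. H \<theta>) = (LINT \<theta>|lebesgue_on (interior C). h \<theta>)"
    using int_sets by (simp add: integral_restrict_space H_def)
  finally show "(\<lambda>k. (\<Sum>\<alpha>\<in>lattice_pts C k. g k \<alpha>) / real k ^ CARD('n))
      \<longlonglongrightarrow> (LINT \<theta>|lebesgue_on (interior C). h \<theta>)"
    unfolding F_def step_fun_integral(2)[OF le_add1[of 1, unfolded plus_1_eq_Suc]] by (rule LIMSEQ_imp_Suc)
qed

end

section \<open>Asymptotics of the Vandermonde suprema\<close>

lemma ext_integral_real:
  assumes h: "integrable M h" and f: "\<And>x. x \<in> space M \<Longrightarrow> f x = ereal (h x)"
  shows "ext_integral_defined M f" "ext_integral M f = ereal (LINT x|M. h x)"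
proof -
  have h': "h \<in> borel_measurable M" "(\<integral>\<^sup>+x. ennreal (h x) \<partial>M) \<noteq> \<infinity>" "(\<integral>\<^sup>+x. ennreal (- h x) \<partial>M) \<noteq> \<infinity>"
    using h by (auto simp: real_integrable_def)
  have p: "(\<integral>\<^sup>+x. e2ennreal (f x) \<partial>M) = (\<integral>\<^sup>+x. ennreal (h x) \<partial>M)"
    by (rule nn_integral_cong) (simp add: f)
  have n: "(\<integral>\<^sup>+x. e2ennreal (- f x) \<partial>M) = (\<integral>\<^sup>+x. ennreal (- h x) \<partial>M)"
    by (rule nn_integral_cong) (simp add: f)
  have "f \<in> borel_measurable M \<longleftrightarrow> (\<lambda>x. ereal (h x)) \<in> borel_measurable M"
    by (rule measurable_cong) (rule f)
  with h' show "ext_integral_defined M f"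
    by (simp add: ext_integral_defined_def p)
  have "enn2ereal x = ereal (enn2real x)" if "x \<noteq> \<infinity>" for x
    using that by (cases x rule: ennreal_cases) auto
  with h' show "ext_integral M f = ereal (LINT x|M. h x)"
    unfolding ext_integral_def p n real_lebesgue_integral_def[OF h] by simp
qed

text \<open>The space must not be null, as \<open>\<infinity> * 0 = 0\<close> would make the
  integral of the negative part vanish. The positive part is 0, so the difference is
  meaningful.\<close>

lemma ext_integral_minus_infinity:
  assumes "emeasure M (space M) \<noteq> 0" and f: "\<And>x. x \<in> space M \<Longrightarrow> f x = - \<infinity>"
  shows "ext_integral_defined M f" "ext_integral M f = - \<infinity>"
proof -
  have p: "(\<integral>\<^sup>+x. e2ennreal (f x) \<partial>M) = (\<integral>\<^sup>+x. 0 \<partial>M)"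
    by (rule nn_integral_cong) (simp add: f e2ennreal_neg)
  have "(\<integral>\<^sup>+x. e2ennreal (- f x) \<partial>M) = (\<integral>\<^sup>+x. \<infinity> \<partial>M)"
    by (rule nn_integral_cong) (simp add: f)
  also have "\<dots> = \<infinity>" using assms(1) by (simp add: ennreal_top_mult)
  finally have n: "(\<integral>\<^sup>+x. e2ennreal (- f x) \<partial>M) = \<infinity>" .
  have "f \<in> borel_measurable M \<longleftrightarrow> (\<lambda>x. - \<infinity> :: ereal) \<in> borel_measurable M"
    by (rule measurable_cong) (rule f)
  then show "ext_integral_defined M f"
    by (simp add: ext_integral_defined_def p)
  show "ext_integral M f = - \<infinity>"
    unfolding ext_integral_def p n by (simp add: zero_ennreal.rep_eq)
qed

lemma measurable_degree: "(\<lambda>\<theta> :: real ^ 'n::finite. \<Sum>i\<in>UNIV. \<theta> $ i) \<in> borel_measurable lebesgue"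
  by (intro measurable_completion borel_measurable_continuous_onI continuous_intros) simp

section \<open>Volume of the body, number and total degree of its lattice points\<close>

context lattice_body
begin

lemma interior_nonempty: "interior C \<noteq> {}"
proof -
  define U :: "(real ^ 'n::{finite,linorder}) set" where "U = (\<Inter>i. {x. 0 < x $ i}) \<inter> {x. (\<Sum>i\<in>UNIV. x $ i) < 1}"
  have "open U"
    unfolding U_def by (intro open_Int open_INT open_Collect_less ballI continuous_intros) auto
  moreover have "U \<subseteq> C"
    using simplex_C by (auto simp: U_def std_simplex_def subset_iff less_imp_le)
  ultimately have "U \<subseteq> interior C" by (rule interior_maximal[rotated])
  moreover have "(\<chi> i. 1 / (2 * real CARD('n))) \<in> U" by (auto simp: U_def)
  ultimately show ?thesis by auto
qed

lemma interior_lmeasurable: "interior C \<in> lmeasurable"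
  using compact_imp_bounded[OF compact_C] by (intro lmeasurable_interior)

lemma measure_interior_C: "measure lebesgue (interior C) = measure lebesgue C"
  using compact_imp_bounded[OF compact_C] negligible_convex_frontier[OF convex_C] by (rule measure_interior)

lemma measure_C_pos: "0 < measure lebesgue C"
proof -
  have "\<not> negligible (interior C)"
    using interior_nonempty open_not_negligible[OF open_interior] by blast
  then have "measure lebesgue (interior C) \<noteq> 0"
    using interior_lmeasurable negligible_iff_measure0 by blast
  then show ?thesis unfolding measure_interior_C[symmetric] by (simp add: zero_less_measure_iff)
qed

lemma emeasure_space_interior: "emeasure (lebesgue_on (interior C)) (space (lebesgue_on (interior C))) \<noteq> 0"
  using measure_C_pos measure_interior_C
  by (auto simp: emeasure_restrict_space space_restrict_space measure_def)

lemma integral_const_interior: "(LINT \<theta>|lebesgue_on (interior C). (c::real)) = c * measure lebesgue C"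
  by (simp add: measure_restrict_space space_restrict_space measure_interior_C)

lemma num_pts_asymp: "(\<lambda>k. real (num_pts C k) / real k ^ CARD('n)) \<longlonglongrightarrow> measure lebesgue C"
  using riemann_sums(2)[of "\<lambda>_ _. 1" 1 "\<lambda>_. 1"] integral_const_interior[of 1]
  by (simp add: num_pts_def)

text \<open>The summands \<open>mdeg \<alpha> / k\<close> sample the coordinate sum of
  \<open>\<theta>\<close>. Positivity of the mean degree is proved alongside, since it uses the
  integrability coming from the same Riemann sums.\<close>

lemma deg_sum_asymp:
  "(\<lambda>k. real (deg_sum C k) / real k / real k ^ CARD('n))
    \<longlonglongrightarrow> (LINT \<theta>|lebesgue_on C. (\<Sum>i\<in>UNIV. \<theta> $ i))"
  and mean_degree_pos: "0 < mean_degree C"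
proof -
  let ?h = "\<lambda>\<theta> :: real ^ 'n::{finite,linorder}. \<Sum>i\<in>UNIV. \<theta> $ i"
  obtain R where R: "\<forall>k\<ge>1. \<forall>\<alpha>\<in>lattice_pts C k. mdeg \<alpha> \<le> k * R" using mdeg_bound by auto
  have bound: "\<bar>real (mdeg \<alpha>) / real k\<bar> \<le> real R" if "1 \<le> k" "\<alpha> \<in> lattice_pts C k" for k \<alpha>
  proof -
    have "real (mdeg \<alpha>) \<le> real (k * R)" using that R of_nat_le_iff by blast
    then show ?thesis using that by (simp add: divide_le_eq mult.commute)
  qed
  have lim: "(\<lambda>k. real (mdeg (floor_vec k \<theta>)) / real k) \<longlonglongrightarrow> ?h \<theta>" if "\<theta> \<in> interior C" for \<theta>
  proof -
    have "(\<lambda>k. ?h ((1 / real k) *\<^sub>R real_vec (floor_vec k \<theta>))) \<longlonglongrightarrow> ?h \<theta>"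
      by (intro tendsto_sum tendsto_vec_nth tendsto_floor_vec interior_nonneg that)
    then show ?thesis by (simp add: mdeg_def real_vec_def sum_divide_distrib)
  qed
  note RS = riemann_sums[of "\<lambda>k \<alpha>. real (mdeg \<alpha>) / real k", OF bound lim]
  have C_sets: "C \<in> sets lebesgue" using compact_imp_closed[OF compact_C] by simp
  have AE_frontier: "AE \<theta> in lebesgue. \<theta> \<notin> frontier C"
    using negligible_convex_frontier[OF convex_C] by (intro AE_not_in) (simp add: negligible_iff_null_sets)
  have "(LINT \<theta>|lebesgue_on C. ?h \<theta>) = (LINT \<theta>|lebesgue. indicator C \<theta> *\<^sub>R ?h \<theta>)"
    using C_sets by (simp add: integral_restrict_space)
  also have "\<dots> = (LINT \<theta>|lebesgue. indicator (interior C) \<theta> *\<^sub>R ?h \<theta>)"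
  proof (rule integral_cong_AE)
    show "AE \<theta> in lebesgue. indicator C \<theta> *\<^sub>R ?h \<theta> = indicator (interior C) \<theta> *\<^sub>R ?h \<theta>"
      using AE_frontier
    proof (rule AE_mp, intro AE_I2 impI)
      fix \<theta> assume "\<theta> \<notin> frontier C"
      then have "\<theta> \<in> C \<longleftrightarrow> \<theta> \<in> interior C"
        using compact_imp_closed[OF compact_C] interior_subset[of C] by (auto simp: frontier_def)
      then show "indicator C \<theta> *\<^sub>R ?h \<theta> = indicator (interior C) \<theta> *\<^sub>R ?h \<theta>"
        by (simp add: indicator_def)
    qed
  qed (intro borel_measurable_scaleR borel_measurable_indicator measurable_degree C_sets
      fmeasurableD[OF interior_lmeasurable])+
  also have "\<dots> = (LINT \<theta>|lebesgue_on (interior C). ?h \<theta>)"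
    by (simp add: integral_restrict_space)
  finally have eq: "(LINT \<theta>|lebesgue_on C. ?h \<theta>) = (LINT \<theta>|lebesgue_on (interior C). ?h \<theta>)" .
  show "(\<lambda>k. real (deg_sum C k) / real k / real k ^ CARD('n)) \<longlonglongrightarrow> (LINT \<theta>|lebesgue_on C. ?h \<theta>)"
    unfolding eq using RS(2) by (simp add: deg_sum_def sum_divide_distrib)
  have fin: "finite_measure (lebesgue_on (interior C))"
    using interior_lmeasurable
    by (intro finite_measureI) (auto simp: emeasure_restrict_space space_restrict_space fmeasurable_def)
  have "(LINT \<theta>|lebesgue_on (interior C). (0::real)) < (LINT \<theta>|lebesgue_on (interior C). ?h \<theta>)"
  proof (rule finite_measure.integral_less_AE_space[OF fin])
    \<comment> \<open>The coordinate sum is positive on the nonnegative orthant except at the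
      origin, a null set.\<close>
    have "AE \<theta> in lebesgue. \<theta> \<notin> {0 :: real ^ 'n::{finite,linorder}}"
      by (intro AE_not_in) (simp add: negligible_iff_null_sets[symmetric])
    then show "AE \<theta> in lebesgue_on (interior C). 0 < ?h \<theta>"
      unfolding AE_restrict_space_iff[of "interior C" lebesgue, simplified]
    proof (rule AE_mp, intro AE_I2 impI)
      fix \<theta> :: "real ^ 'n::{finite,linorder}" assume "\<theta> \<notin> {0}" "\<theta> \<in> interior C"
      then obtain i where "\<theta> $ i \<noteq> 0" by (auto simp: vec_eq_iff)
      with interior_nonneg[OF \<open>\<theta> \<in> interior C\<close>] show "0 < ?h \<theta>"
        by (intro sum_pos2[of _ i]) (auto simp: order_less_le)
    qed
  qed (use RS(1) emeasure_space_interior in auto)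
  then show "0 < mean_degree C"
    unfolding mean_degree_def eq using measure_C_pos by simp
qed

text \<open>This is the factor between the exponents \<open>1/(k M_k)\<close> and
  \<open>1/L_k\<close>, the source of the power \<open>1/A_N\<close> in the transfinite
  diameter.\<close>

lemma deg_sum_ratio: "(\<lambda>k. real k * real (num_pts C k) / real (deg_sum C k)) \<longlonglongrightarrow> 1 / mean_degree C"
proof -
  let ?I = "LINT \<theta>|lebesgue_on C. (\<Sum>i\<in>UNIV. \<theta> $ i)"
  have I: "1 / mean_degree C = measure lebesgue C / ?I" by (simp add: mean_degree_def)
  have "?I \<noteq> 0" using mean_degree_pos by (auto simp: mean_degree_def)
  then have "(\<lambda>k. (real (num_pts C k) / real k ^ CARD('n)) / (real (deg_sum C k) / real k / real k ^ CARD('n)))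
      \<longlonglongrightarrow> 1 / mean_degree C"
    unfolding I by (intro tendsto_divide num_pts_asymp deg_sum_asymp)
  then show ?thesis
    by (rule Lim_transform_eventually)
      (use eventually_gt_at_top[of 0] in eventually_elim, simp add: field_simps)
qed

text \<open>Polynomial growth of the number of points is invisible to k-th roots; this disposes of
  the factorial.\<close>

lemma num_pts_root: "(\<lambda>k. real (num_pts C k) powr (1 / real k)) \<longlonglongrightarrow> 1"
proof -
  have "(\<lambda>k. (real (num_pts C k) / real k ^ CARD('n)) powr (1 / real k) * root k (real k) ^ CARD('n))
      \<longlonglongrightarrow> measure lebesgue C powr 0 * 1 ^ CARD('n)"
    using measure_C_pos by (intro tendsto_intros num_pts_asymp LIMSEQ_root lim_const_over_n) auto
  then have "(\<lambda>k. (real (num_pts C k) / real k ^ CARD('n)) powr (1 / real k) * root k (real k) ^ CARD('n))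
      \<longlonglongrightarrow> 1"
    using measure_C_pos by simp
  then show ?thesis
  proof (rule Lim_transform_eventually)
    show "\<forall>\<^sub>F k in sequentially. (real (num_pts C k) / real k ^ CARD('n)) powr (1 / real k) *
        root k (real k) ^ CARD('n) = real (num_pts C k) powr (1 / real k)"
      using eventually_gt_at_top[of 0]
    proof eventually_elim
      case (elim k)
      have "root k (real k) ^ CARD('n) = (real k ^ CARD('n)) powr (1 / real k)"
        using elim by (simp add: root_powr_inverse powr_realpow[symmetric] powr_powr mult.commute)
      then show ?case using elim by (simp add: powr_mult[symmetric])
    qed
  qed
qed

text \<open>The geometric mean of \<open>g k\<close> over the lattice points. The k-th powers make
  the product for \<open>root_\<tau>\<close> that of the values of \<open>\<tau>\<close>. Unlike the
  exponential of a mean logarithm, the formula gives the right value 0 when a factor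
  vanishes.\<close>

definition geom_mean :: "(nat \<Rightarrow> nat ^ 'n::{finite,linorder} \<Rightarrow> real) \<Rightarrow> nat \<Rightarrow> real" where
  "geom_mean g k = (\<Prod>\<alpha>\<in>lattice_pts C k. g k \<alpha> ^ k) powr (1 / (real k * real (num_pts C k)))"

lemma geom_mean_eq:
  assumes "1 \<le> k" "\<And>\<alpha>. \<alpha> \<in> lattice_pts C k \<Longrightarrow> 0 < g k \<alpha>"
  shows "geom_mean g k = exp ((\<Sum>\<alpha>\<in>lattice_pts C k. ln (g k \<alpha>)) / real (num_pts C k))"
proof -
  have pos: "0 < (\<Prod>\<alpha>\<in>lattice_pts C k. g k \<alpha> ^ k)" using assms by (intro prod_pos) simp
  have "ln (\<Prod>\<alpha>\<in>lattice_pts C k. g k \<alpha> ^ k) = (\<Sum>\<alpha>\<in>lattice_pts C k. ln (g k \<alpha> ^ k))"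
    using finite_lattice_pts[OF assms(1)] by (intro ln_prod) (auto dest: assms(2))
  also have "\<dots> = real k * (\<Sum>\<alpha>\<in>lattice_pts C k. ln (g k \<alpha>))"
    using assms by (simp add: ln_realpow sum_distrib_left)
  finally show ?thesis
    using pos assms(1) by (simp add: geom_mean_def powr_def)
qed

text \<open>Two-sided positive bounds keep the logarithms bounded, so their normalised sums are
  admissible Riemann sums; dividing by the normalised number of points turns them into
  averages.\<close>

lemma geom_mean_limit:
  assumes b: "0 < b"
    and bounds: "\<And>k \<alpha>. 1 \<le> k \<Longrightarrow> \<alpha> \<in> lattice_pts C k \<Longrightarrow> b \<le> g k \<alpha> \<and> g k \<alpha> \<le> b'"
    and lim: "\<And>\<theta>. \<theta> \<in> interior C \<Longrightarrow> (\<lambda>k. g k (floor_vec k \<theta>)) \<longlonglongrightarrow> h \<theta>"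
    and h: "\<And>\<theta>. \<theta> \<in> interior C \<Longrightarrow> h \<theta> \<noteq> 0"
  shows "integrable (lebesgue_on (interior C)) (\<lambda>\<theta>. ln (h \<theta>))"
    and "geom_mean g \<longlonglongrightarrow> exp ((LINT \<theta>|lebesgue_on (interior C). ln (h \<theta>)) / measure lebesgue C)"
proof -
  have ln_bound: "\<bar>ln (g k \<alpha>)\<bar> \<le> \<bar>ln b\<bar> + \<bar>ln b'\<bar>" if "1 \<le> k" "\<alpha> \<in> lattice_pts C k" for k \<alpha>
  proof -
    have "ln b \<le> ln (g k \<alpha>)" "ln (g k \<alpha>) \<le> ln b'"
      using bounds[OF that] b by auto
    then show ?thesis by linarith
  qed
  have ln_lim: "(\<lambda>k. ln (g k (floor_vec k \<theta>))) \<longlonglongrightarrow> ln (h \<theta>)" if "\<theta> \<in> interior C" for \<theta>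
    by (intro tendsto_ln lim h that)
  note RS = riemann_sums[of "\<lambda>k \<alpha>. ln (g k \<alpha>)", OF ln_bound ln_lim]
  show "integrable (lebesgue_on (interior C)) (\<lambda>\<theta>. ln (h \<theta>))" by (rule RS(1))
  have "(\<lambda>k. exp ((\<Sum>\<alpha>\<in>lattice_pts C k. ln (g k \<alpha>)) / real k ^ CARD('n) / (real (num_pts C k) / real k ^ CARD('n))))
      \<longlonglongrightarrow> exp ((LINT \<theta>|lebesgue_on (interior C). ln (h \<theta>)) / measure lebesgue C)"
    using measure_C_pos by (intro tendsto_exp tendsto_divide RS(2) num_pts_asymp) auto
  then show "geom_mean g \<longlonglongrightarrow> exp ((LINT \<theta>|lebesgue_on (interior C). ln (h \<theta>)) / measure lebesgue C)"
  proof (rule Lim_transform_eventually)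
    show "\<forall>\<^sub>F k in sequentially.
        exp ((\<Sum>\<alpha>\<in>lattice_pts C k. ln (g k \<alpha>)) / real k ^ CARD('n) / (real (num_pts C k) / real k ^ CARD('n)))
        = geom_mean g k"
      using eventually_ge_at_top[of 1]
    proof eventually_elim
      case (elim k)
      have "0 < g k \<alpha>" if "\<alpha> \<in> lattice_pts C k" for \<alpha>
        using bounds[OF elim that] b by linarith
      from geom_mean_eq[of k g, OF elim this] show ?case using elim by simp
    qed
  qed
qed

end

section \<open>Geometric means of submultiplicative functions\<close>

context submultiplicative_body
begin

definition dir_limit :: "real ^ 'n::{finite,linorder} \<Rightarrow> real" where
  "dir_limit \<theta> = Lim (direction_filter C \<theta>) (\<lambda>(k, \<alpha>). root_\<tau> k \<alpha>)"

lemma dir_limit: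
  assumes "\<theta> \<in> interior C"
  shows "0 \<le> dir_limit \<theta>"
    and "((\<lambda>x. root_\<tau> (fst x) (snd x)) \<longlongrightarrow> dir_limit \<theta>) (direction_filter C \<theta>)"
proof -
  obtain L where L: "0 \<le> L" "((\<lambda>x. root_\<tau> (fst x) (snd x)) \<longlongrightarrow> L) (direction_filter C \<theta>)"
    by (rule convergent_root_\<tau>[OF assms])
  then have "dir_limit \<theta> = L"
    unfolding dir_limit_def using direction_filter_neq_bot[OF assms]
    by (simp add: tendsto_Lim case_prod_unfold)
  with L show "0 \<le> dir_limit \<theta>"
    "((\<lambda>x. root_\<tau> (fst x) (snd x)) \<longlongrightarrow> dir_limit \<theta>) (direction_filter C \<theta>)" by auto
qed

lemma root_\<tau>_floor_vec:
  "\<theta> \<in> interior C \<Longrightarrow> (\<lambda>k. root_\<tau> k (floor_vec k \<theta>)) \<longlonglongrightarrow> dir_limit \<theta>"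
  using filterlim_compose[OF dir_limit(2) filterlim_floor_vec] by simp

lemma geom_mean_root_\<tau>:
  "1 \<le> k \<Longrightarrow> geom_mean root_\<tau> k = (\<Prod>\<alpha>\<in>lattice_pts C k. \<tau> k \<alpha>) powr (1 / (real k * real (num_pts C k)))"
  by (simp add: geom_mean_def root_\<tau>_power)

text \<open>By \<open>root_\<tau>_bounded_below\<close>, one positive interior limit bounds all
  roots away from 0, so the logarithm is either integrable or identically
  \<open>- \<infinity>\<close>. No mixed case has to be integrated.\<close>

lemma geom_mean_root_\<tau>_limit:
  obtains D where "0 \<le> D" "geom_mean root_\<tau> \<longlonglongrightarrow> D"
    "ext_integral_defined (lebesgue_on (interior C)) (\<lambda>\<theta>. ln_ext (dir_limit \<theta>))"
    "ereal D = exp_ext (ereal (1 / measure lebesgue C) *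
      ext_integral (lebesgue_on (interior C)) (\<lambda>\<theta>. ln_ext (dir_limit \<theta>)))"
proof (cases "\<exists>\<theta>\<in>interior C. 0 < dir_limit \<theta>")
  case True
  then obtain \<theta>0 where \<theta>0: "\<theta>0 \<in> interior C" "0 < dir_limit \<theta>0" by auto
  obtain b where b: "0 < b" "\<And>k \<alpha>. 1 \<le> k \<Longrightarrow> \<alpha> \<in> lattice_pts C k \<Longrightarrow> b \<le> root_\<tau> k \<alpha>"
    using root_\<tau>_bounded_below[OF \<theta>0 dir_limit(2)[OF \<theta>0(1)]] by blast
  have pos: "b \<le> dir_limit \<theta>" if "\<theta> \<in> interior C" for \<theta>
  proof (rule tendsto_lowerbound[OF dir_limit(2)[OF that] _ direction_filter_neq_bot[OF that]])
    show "\<forall>\<^sub>F x in direction_filter C \<theta>. b \<le> root_\<tau> (fst x) (snd x)"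
      using eventually_good_direction by eventually_elim (use b in auto)
  qed
  have nz: "dir_limit \<theta> \<noteq> 0" if "\<theta> \<in> interior C" for \<theta> using pos[OF that] b by auto
  have bounds: "b \<le> root_\<tau> k \<alpha> \<and> root_\<tau> k \<alpha> \<le> B" if "1 \<le> k" "\<alpha> \<in> lattice_pts C k" for k \<alpha>
    using b root_\<tau>_le that by auto
  note GM = geom_mean_limit[of b root_\<tau> B dir_limit, OF b(1) bounds root_\<tau>_floor_vec nz]
  have ln: "ln_ext (dir_limit \<theta>) = ereal (ln (dir_limit \<theta>))" if "\<theta> \<in> space (lebesgue_on (interior C))" for \<theta>
    using nz[of \<theta>] that by (simp add: ln_ext_def space_restrict_space)
  have E1: "ext_integral_defined (lebesgue_on (interior C)) (\<lambda>\<theta>. ln_ext (dir_limit \<theta>))"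
    by (rule ext_integral_real(1)[OF GM(1)]) (assumption | erule ln)+
  have E2: "ext_integral (lebesgue_on (interior C)) (\<lambda>\<theta>. ln_ext (dir_limit \<theta>)) =
      ereal (LINT \<theta>|lebesgue_on (interior C). ln (dir_limit \<theta>))"
    by (rule ext_integral_real(2)[OF GM(1)]) (assumption | erule ln)+
  show ?thesis
  proof (rule that[OF _ GM(2) E1])
    show "ereal (exp ((LINT \<theta>|lebesgue_on (interior C). ln (dir_limit \<theta>)) / measure lebesgue C)) =
        exp_ext (ereal (1 / measure lebesgue C) *
          ext_integral (lebesgue_on (interior C)) (\<lambda>\<theta>. ln_ext (dir_limit \<theta>)))"
      unfolding E2 by (simp add: exp_ext_def)
  qed simp
next
  case False
  then have zero: "dir_limit \<theta> = 0" if "\<theta> \<in> interior C" for \<theta>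
    using dir_limit(1)[OF that] that by force
  have ln: "ln_ext (dir_limit \<theta>) = - \<infinity>" if "\<theta> \<in> space (lebesgue_on (interior C))" for \<theta>
    using zero[of \<theta>] that by (simp add: ln_ext_def space_restrict_space)
  have E1: "ext_integral_defined (lebesgue_on (interior C)) (\<lambda>\<theta>. ln_ext (dir_limit \<theta>))"
    by (rule ext_integral_minus_infinity(1)[OF emeasure_space_interior ln])
  have E2: "ext_integral (lebesgue_on (interior C)) (\<lambda>\<theta>. ln_ext (dir_limit \<theta>)) = - \<infinity>"
    by (rule ext_integral_minus_infinity(2)[OF emeasure_space_interior ln])
  have "geom_mean root_\<tau> \<longlonglongrightarrow> 0"
  proof (rule order_tendstoI)
    show "\<forall>\<^sub>F k in sequentially. a < geom_mean root_\<tau> k" if "a < 0" for a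
      using that by (intro always_eventually) (auto simp: geom_mean_def intro: order_less_le_trans)
  next
    fix \<epsilon> :: real assume "0 < \<epsilon>"
    \<comment> \<open>Truncation at \<open>\<rho>\<close> only raises the mean, and because all
      interior limits are 0, the truncated means converge exactly to
      \<open>\<rho> < \<epsilon>\<close>.\<close>
    define \<rho> where "\<rho> = \<epsilon> / 2"
    have \<rho>: "0 < \<rho>" "\<rho> < \<epsilon>" using \<open>0 < \<epsilon>\<close> by (auto simp: \<rho>_def)
    define g where "g = (\<lambda>k \<alpha>. max (root_\<tau> k \<alpha>) \<rho>)"
    have bounds: "\<rho> \<le> g k \<alpha> \<and> g k \<alpha> \<le> max B \<rho>" if "1 \<le> k" "\<alpha> \<in> lattice_pts C k" for k \<alpha>
      using root_\<tau>_le[OF that] by (auto simp: g_def)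
    have lim: "(\<lambda>k. g k (floor_vec k \<theta>)) \<longlonglongrightarrow> \<rho>" if "\<theta> \<in> interior C" for \<theta>
      using tendsto_max[OF root_\<tau>_floor_vec[OF that] tendsto_const[of \<rho>]] zero[OF that] \<rho>
      by (simp add: g_def)
    have nz: "\<rho> \<noteq> 0" using \<rho> by simp
    have "geom_mean g \<longlonglongrightarrow> exp ((LINT \<theta>|lebesgue_on (interior C). ln \<rho>) / measure lebesgue C)"
      by (rule geom_mean_limit(2)[where h = "\<lambda>_. \<rho>" and g = g, OF \<rho>(1) bounds lim nz])
    also have "exp ((LINT \<theta>|lebesgue_on (interior C). ln \<rho>) / measure lebesgue C) = \<rho>"
      unfolding integral_const_interior using measure_C_pos \<rho> by simp
    finally have ev: "\<forall>\<^sub>F k in sequentially. geom_mean g k < \<epsilon>"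
      using \<rho> by (intro order_tendstoD(2))
    have le: "geom_mean root_\<tau> k \<le> geom_mean g k" for k
      unfolding geom_mean_def using root_\<tau>_nonneg
      by (intro powr_mono2 prod_mono prod_nonneg conjI power_mono) (auto simp: g_def)
    show "\<forall>\<^sub>F k in sequentially. geom_mean root_\<tau> k < \<epsilon>"
      using ev by eventually_elim (rule le_less_trans[OF le])
  qed
  moreover have "ereal 0 = exp_ext (ereal (1 / measure lebesgue C) *
      ext_integral (lebesgue_on (interior C)) (\<lambda>\<theta>. ln_ext (dir_limit \<theta>)))"
    using measure_C_pos by (simp add: E2 exp_ext_def)
  ultimately show ?thesis using that[of 0] E1 by simp
qed

lemma limit_between_products:
  assumes lower: "\<And>k. 1 \<le> k \<Longrightarrow> (\<Prod>\<alpha>\<in>lattice_pts C k. \<tau> k \<alpha>) \<le> V k"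
    and upper: "\<And>k. 1 \<le> k \<Longrightarrow> V k \<le> fact (num_pts C k) * (\<Prod>\<alpha>\<in>lattice_pts C k. \<tau> k \<alpha>)"
    and D: "geom_mean root_\<tau> \<longlonglongrightarrow> D"
  shows "(\<lambda>k. V k powr (1 / (real k * real (num_pts C k)))) \<longlonglongrightarrow> D"
proof (rule tendsto_sandwich[OF _ _ D])
  show "(\<lambda>k. real (num_pts C k) powr (1 / real k) * geom_mean root_\<tau> k) \<longlonglongrightarrow> D"
    using tendsto_mult[OF num_pts_root D] by simp
  have P: "0 \<le> (\<Prod>\<alpha>\<in>lattice_pts C k. \<tau> k \<alpha>)" for k by (intro prod_nonneg \<tau>_nonneg)
  show "\<forall>\<^sub>F k in sequentially. geom_mean root_\<tau> k \<le> V k powr (1 / (real k * real (num_pts C k)))"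
    using eventually_ge_at_top[of 1]
    by eventually_elim (use lower P in \<open>auto simp: geom_mean_root_\<tau> intro!: powr_mono2\<close>)
  show "\<forall>\<^sub>F k in sequentially. V k powr (1 / (real k * real (num_pts C k)))
      \<le> real (num_pts C k) powr (1 / real k) * geom_mean root_\<tau> k"
    using eventually_ge_at_top[of 1]
  proof eventually_elim
    case (elim k)
    let ?M = "num_pts C k" and ?P = "\<Prod>\<alpha>\<in>lattice_pts C k. \<tau> k \<alpha>"
    have M: "0 < ?M" using num_pts_pos[OF elim] .
    \<comment> \<open>The crude bound of the factorial by \<open>M ^ M\<close> suffices: its root of
      order \<open>k * M\<close> is the k-th root of \<open>M\<close>.\<close>
    have "V k \<le> real ?M ^ ?M * ?P"
      using upper[OF elim] mult_right_mono[OF fact_le_power[of ?M, where 'a = real] P[of k]] by simp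
    then have "V k powr (1 / (real k * real ?M)) \<le> (real ?M ^ ?M * ?P) powr (1 / (real k * real ?M))"
      using lower[OF elim] P[of k] by (intro powr_mono2) auto
    also have "\<dots> = real ?M powr (1 / real k) * geom_mean root_\<tau> k"
      using M elim P[of k] by (simp add: powr_mult powr_realpow[symmetric] powr_powr geom_mean_root_\<tau>)
    finally show ?case .
  qed
qed

end

theorem theorem4p6:
  fixes C :: "(real ^ 'n::{finite,linorder}) set"
    and K :: "(complex ^ 'n::{finite,linorder}) set"
    and w :: "complex ^ 'n::{finite,linorder} \<Rightarrow> real"
    and e :: "nat \<Rightarrow> nat \<Rightarrow> nat ^ 'n::{finite,linorder}"
  assumes "C \<subseteq> {x. \<forall>i. 0 \<le> x $ i}"
    and "compact C" and "convex C"
    and "std_simplex \<subseteq> C"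
    and "compact K"
    and "continuous_on K w" and "\<And>z. z \<in> K \<Longrightarrow> 0 \<le> w z"
    and "\<And>k. k \<ge> 1 \<Longrightarrow> bij_betw (e k) {..<num_pts C k} (lattice_pts C k)"
  shows "convergent (diam_seq e C K w)
    \<and> ext_integral_defined (lebesgue_on (interior C)) (\<lambda>\<theta>. ln_ext (directional_cheb C K w \<theta>))
    \<and> ereal (diam_lim e C K w) =
        exp_ext (ereal (1 / measure lebesgue C) *
          ext_integral (lebesgue_on (interior C)) (\<lambda>\<theta>. ln_ext (directional_cheb C K w \<theta>)))
    \<and> transfinite_diam e C K w = ereal (diam_lim e C K w powr (1 / mean_degree C))"
proof -
  interpret weighted_body C K w
    by unfold_locales (use assms in auto)
  obtain B where B: "1 \<le> B"
    "\<forall>k\<ge>1. \<forall>\<alpha>\<in>lattice_pts C k. min_weighted C K w k \<alpha> \<le> B ^ k"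
    using min_weighted_bound by auto
  interpret submultiplicative_body C "min_weighted C K w" B
    by unfold_locales (use B min_weighted_nonneg min_weighted_add in auto)
  have "root_\<tau> = cheb C K w"
    by (simp add: fun_eq_iff root_\<tau>_def cheb_def min_weighted_def)
  then have dir: "dir_limit = directional_cheb C K w"
    by (simp add: fun_eq_iff dir_limit_def directional_cheb_def)
  obtain D where D: "0 \<le> D" "geom_mean root_\<tau> \<longlonglongrightarrow> D"
    and int: "ext_integral_defined (lebesgue_on (interior C)) (\<lambda>\<theta>. ln_ext (directional_cheb C K w \<theta>))"
    and eq: "ereal D = exp_ext (ereal (1 / measure lebesgue C) *
      ext_integral (lebesgue_on (interior C)) (\<lambda>\<theta>. ln_ext (directional_cheb C K w \<theta>)))"
    using geom_mean_root_\<tau>_limit unfolding dir by blast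
  have lim: "diam_seq e C K w \<longlonglongrightarrow> D"
    unfolding diam_seq_def[abs_def]
    by (rule limit_between_products[OF vandermonde_bounds D(2)]) (use assms(8) in auto)
  have diam: "diam_lim e C K w = D"
    unfolding diam_lim_def by (rule limI[OF lim])
  \<comment> \<open>Changing the exponent remains valid when \<open>D = 0\<close>, because the
    exponents tend to a positive number and the terms are nonnegative. The upper limit in the
    transfinite diameter is then a limit.\<close>
  have "(\<lambda>k. diam_seq e C K w k powr (real k * real (num_pts C k) / real (deg_sum C k)))
      \<longlonglongrightarrow> D powr (1 / mean_degree C)"
    using mean_degree_pos by (intro tendsto_powr' lim deg_sum_ratio) (auto simp: diam_seq_def)
  then have "(\<lambda>k. vandermonde e C K w k powr (1 / real (deg_sum C k))) \<longlonglongrightarrow> D powr (1 / mean_degree C)"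
  proof (rule Lim_transform_eventually)
    show "\<forall>\<^sub>F k in sequentially. diam_seq e C K w k powr (real k * real (num_pts C k) / real (deg_sum C k))
        = vandermonde e C K w k powr (1 / real (deg_sum C k))"
      using eventually_ge_at_top[of 1]
    proof eventually_elim
      case (elim k)
      then show ?case using num_pts_pos[OF elim] by (simp add: diam_seq_def powr_powr)
    qed
  qed
  then have "transfinite_diam e C K w = ereal (D powr (1 / mean_degree C))"
    unfolding transfinite_diam_def by (intro lim_imp_Limsup tendsto_ereal) auto
  then show ?thesis
    using lim int eq by (auto simp: diam convergent_def)
qed

end
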